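(* Let $s\in\mathbb R$ and let $(s_n)_{n\in\mathbb N}$ be a sequence of real numbers such that $\mu n+s_n n^\gamma\in\mathbb N_0$ for all $n\in\mathbb N$ and $\lim_{n\to\infty}s_n=s$. Let $Q_{n,s_n}$ be the distribution of $M_n/n^\gamma$ under the conditional law $\mathbb P(\,\cdot\mid S_n=\mu n+s_n n^\gamma)$. Then $(Q_{n,s_n})_{n\in\mathbb N}$ satisfies the large deviation principle on $\mathbb R_+$ with speed $n^{\gamma\alpha}$ and good rate function $f_s-\inf_{\mathbb R_+}f_s$. That is, $f_s$ is lower semicontinuous with compact (sub)level sets, for every closed set $A\subset\mathbb R_+$ $$\limsup_{n\to\infty}\frac1{n^{\gamma\alpha}}\log\mathbb P\Bigl(\frac{M_n}{n^\gamma}\in A\,\Big|\,S_n=\mu n+s_nn^\gamma\Bigr)\le-\inf_{y\in A}\bigl(f_s(y)-\inf_{\mathbb R_+}f_s\bigr),$$ and for every open set $O\subset\mathbb R_+$ $$\liminf_{n\to\infty}\frac1{n^{\gamma\alpha}}\log\mathbb P\Bigl(\frac{M_n}{n^\gamma}\in O\,\Big|\,S_n=\mu n+s_nn^\gamma\Bigr)\ge-\inf_{y\in O}\bigl(f_s(y)-\inf_{\mathbb R_+}f_s\bigr).$$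
   Context: Notation: $\mathbb N=\{1,2,\ldots\}$, $\mathbb N_0=\mathbb N\cup\{0\}$, $\mathbb R_+=[0,\infty)$; $\log 0=-\infty$, $\inf\varnothing=+\infty$. Fix $\alpha\in(0,1)$, let $c=1/\sum_{k\in\mathbb N_0}\exp(-k^\alpha)$ and $\gamma=1/(2-\alpha)$. Let $X_1,X_2,\ldots$ be i.i.d. $\mathbb N_0$-valued random variables with $\mathbb P(X_i=k)=c\exp(-k^\alpha)$ for $k\in\mathbb N_0$, with expected value $\mu=\mathbb E[X_i]$ and variance $\sigma^2$. Put $S_n=X_1+\cdots+X_n$ and $M_n=\max(X_1,\ldots,X_n)$. Let $\mathcal D\subset\mathbb R_+^{\mathbb N}$ be the set of decreasing sequences $x_1\ge x_2\ge\cdots$ (of numbers in $\mathbb R_+$). For $s\in\mathbb R$ define $F_s:\mathcal D\to\mathbb R_+\cup\{\infty\}$ by $$F_s(x_1,x_2,\ldots)=\sum_{j=1}^\infty x_j^\alpha+\frac1{2\sigma^2}\Bigl(s-\sum_{j=1}^\infty x_j\Bigr)^2$$ (equal to $\infty$ if one of the sums diverges), and $f_s:\mathbb R_+\to\mathbb R$ by $f_s(y)=\inf\{F_s(x_1,x_2,\ldots):\ (x_j)_{j\in\mathbb N}\in\mathcal D,\ x_1=y\}$. *)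

theory Defs
  imports "HOL-Probability.Probability"
begin

definition norm_const :: "real \<Rightarrow> real" where
  "norm_const \<alpha> = 1 / (\<Sum>k::nat. exp (- (real k powr \<alpha>)))"

definition gam :: "real \<Rightarrow> real" where
  "gam \<alpha> = 1 / (2 - \<alpha>)"

definition elog :: "real \<Rightarrow> ereal" where
  "elog p = (if p = 0 then - \<infinity> else ereal (ln p))"


definition lower_semicontinuous_on :: "'a::topological_space set \<Rightarrow> ('a \<Rightarrow> ereal) \<Rightarrow> bool" where
  "lower_semicontinuous_on E I \<longleftrightarrow> (\<forall>y\<in>E. I y \<le> Liminf (at y within E) I)"

definition good_rate_function_on :: "'a::topological_space set \<Rightarrow> ('a \<Rightarrow> ereal) \<Rightarrow> bool" where
  "good_rate_function_on E I \<longleftrightarrow>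
     (\<forall>y\<in>E. 0 \<le> I y) \<and> lower_semicontinuous_on E I \<and>
     (\<forall>r::real. compact {y\<in>E. I y \<le> ereal r})"

text \<open>The measures \<open>Q n\<close> live on \<open>E\<close>, hence closed and open are understood relative to \<open>E\<close>.
  In the bounds, the infimum over the empty set is \<open>\<infinity>\<close>, as an infimum in \<^typ>\<open>ereal\<close>.\<close>

definition satisfies_LDP_on ::
  "'a::topological_space set \<Rightarrow> (nat \<Rightarrow> 'a measure) \<Rightarrow> (nat \<Rightarrow> real) \<Rightarrow> ('a \<Rightarrow> ereal) \<Rightarrow> bool" where
  "satisfies_LDP_on E Q a I \<longleftrightarrow>
     (\<forall>A. closedin (top_of_set E) A \<longrightarrow>
        limsup (\<lambda>n. elog (measure (Q n) A) / ereal (a n)) \<le> - (INF y\<in>A. I y)) \<and>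
     (\<forall>U. openin (top_of_set E) U \<longrightarrow>
        - (INF y\<in>U. I y) \<le> liminf (\<lambda>n. elog (measure (Q n) U) / ereal (a n)))"


text \<open>Sequences are indexed from 0, so the \<open>j\<close>-th term in the mathematical notation is
  \<open>x (j - 1)\<close>; in particular the first term is \<open>x 0\<close>.\<close>

definition dec_seqs :: "(nat \<Rightarrow> real) set" where
  "dec_seqs = {x. decseq x \<and> (\<forall>j. 0 \<le> x j)}"

definition F_fun :: "real \<Rightarrow> real \<Rightarrow> real \<Rightarrow> (nat \<Rightarrow> real) \<Rightarrow> ereal" where
  "F_fun \<alpha> \<sigma> s x =
     (if summable (\<lambda>j. x j powr \<alpha>) \<and> summable x
      then ereal ((\<Sum>j. x j powr \<alpha>) + 1 / (2 * \<sigma>\<^sup>2) * (s - (\<Sum>j. x j))\<^sup>2)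
      else \<infinity>)"

definition f_fun :: "real \<Rightarrow> real \<Rightarrow> real \<Rightarrow> real \<Rightarrow> real" where
  "f_fun \<alpha> \<sigma> s y = real_of_ereal (INF x\<in>{x\<in>dec_seqs. x 0 = y}. F_fun \<alpha> \<sigma> s x)"

text \<open>The conversion to \<^typ>\<open>real\<close> loses nothing: the infimum is finite.\<close>

lemma F_fun_nonneg:
  assumes "x \<in> dec_seqs"
  shows "0 \<le> F_fun \<alpha> \<sigma> s x"
  using assms by (auto simp: F_fun_def dec_seqs_def intro!: add_nonneg_nonneg suminf_nonneg)

lemma ereal_f_fun:
  assumes "0 \<le> y"
  shows "ereal (f_fun \<alpha> \<sigma> s y) = (INF x\<in>{x\<in>dec_seqs. x 0 = y}. F_fun \<alpha> \<sigma> s x)"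
proof -
  let ?I = "INF x\<in>{x\<in>dec_seqs. x 0 = y}. F_fun \<alpha> \<sigma> s x"
  define z where "z = (\<lambda>j::nat. if j = 0 then y else 0)"
  have z: "z \<in> {x\<in>dec_seqs. x 0 = y}"
    using assms by (auto simp: z_def dec_seqs_def decseq_def)
  have "summable z" "summable (\<lambda>j. z j powr \<alpha>)"
    by (rule summable_finite[of "{0}"]; simp add: z_def)+
  then have "F_fun \<alpha> \<sigma> s z < \<infinity>"
    by (simp add: F_fun_def)
  moreover have "?I \<le> F_fun \<alpha> \<sigma> s z"
    using z by (rule INF_lower)
  moreover have "0 \<le> ?I"
    by (rule INF_greatest) (auto intro: F_fun_nonneg)
  ultimately have "\<bar>?I\<bar> \<noteq> \<infinity>"
    by auto
  then show ?thesis
    unfolding f_fun_def by (simp add: ereal_real')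
qed


definition partial_sum :: "(nat \<Rightarrow> 'a \<Rightarrow> nat) \<Rightarrow> nat \<Rightarrow> 'a \<Rightarrow> nat" where
  "partial_sum X n \<omega> = (\<Sum>i\<in>{1..n}. X i \<omega>)"

definition partial_max :: "(nat \<Rightarrow> 'a \<Rightarrow> nat) \<Rightarrow> nat \<Rightarrow> 'a \<Rightarrow> nat" where
  "partial_max X n \<omega> = Max ((\<lambda>i. X i \<omega>) ` {1..n})"

definition cond_max_law ::
  "'a measure \<Rightarrow> (nat \<Rightarrow> 'a \<Rightarrow> nat) \<Rightarrow> real \<Rightarrow> nat \<Rightarrow> real \<Rightarrow> real measure" where
  "cond_max_law M X \<alpha> n v =
     distr (uniform_measure M {\<omega> \<in> space M. real (partial_sum X n \<omega>) = v})
       (restrict_space borel {0..})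
       (\<lambda>\<omega>. real (partial_max X n \<omega>) / real n powr gam \<alpha>)"

lemma (in prob_space) measure_cond_max_law:
  assumes X: "\<And>i. 1 \<le> i \<Longrightarrow> X i \<in> measurable M (count_space UNIV)"
    and A: "A \<in> sets borel" "A \<subseteq> {0..}"
    and n: "1 \<le> n"
  shows "measure (cond_max_law M X \<alpha> n v) A =
    \<P>(\<omega> in M. real (partial_max X n \<omega>) / real n powr gam \<alpha> \<in> A \<bar> real (partial_sum X n \<omega>) = v)"
proof -
  let ?B = "{\<omega> \<in> space M. real (partial_sum X n \<omega>) = v}"
  let ?Y = "\<lambda>\<omega>. real (partial_max X n \<omega>) / real n powr gam \<alpha>"
  have Xn: "X i \<in> measurable M (count_space UNIV)" if "i \<in> {1..n}" for i
    using X that by simp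
  have S: "(\<lambda>\<omega>. real (partial_sum X n \<omega>)) \<in> borel_measurable M"
    unfolding partial_sum_def of_nat_sum
    by (rule borel_measurable_sum) (rule measurable_compose[OF Xn], auto)
  have "(\<lambda>\<omega>. Max ((\<lambda>i. real (X i \<omega>)) ` {1..n})) \<in> borel_measurable M"
    using n by (intro borel_measurable_Max) (auto intro!: measurable_compose[OF Xn])
  moreover have "Max ((\<lambda>i. real (X i \<omega>)) ` {1..n}) = real (partial_max X n \<omega>)" for \<omega>
    unfolding partial_max_def
    using n by (subst mono_Max_commute[where f = real]) (auto simp: mono_def image_image)
  ultimately have "(\<lambda>\<omega>. real (partial_max X n \<omega>)) \<in> borel_measurable M"
    by simp
  then have Y': "?Y \<in> borel_measurable M"
    by (rule borel_measurable_divide) simp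
  have Y: "?Y \<in> measurable (uniform_measure M ?B) (restrict_space borel {0..})"
    using Y' by (intro measurable_restrict_space2) auto
  have "A \<in> sets (restrict_space borel {0..})"
    using A by (subst sets_restrict_space_iff) auto
  then have "measure (cond_max_law M X \<alpha> n v) A =
      \<P>(\<omega> in uniform_measure M ?B. ?Y \<omega> \<in> A)"
    unfolding cond_max_law_def using Y
    by (subst measure_distr) (auto intro!: arg_cong[where f = "measure _"])
  also have "\<dots> = \<P>(\<omega> in M. ?Y \<omega> \<in> A \<bar> real (partial_sum X n \<omega>) = v)"
  proof (rule measure_uniform_measure_eq_cond_prob)
    show "Measurable.pred M (\<lambda>\<omega>. ?Y \<omega> \<in> A)"
      using measurable_sets[OF Y' A(1)] by (simp add: pred_def vimage_def Int_def conj_commute)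
    show "Measurable.pred M (\<lambda>\<omega>. real (partial_sum X n \<omega>) = v)"
      using measurable_sets[OF S, of "{v}"] by (simp add: pred_def vimage_def Int_def conj_commute)
  qed
  finally show ?thesis .
qed

end

theory Submission
  imports Defs "HOL-Real_Asymp.Real_Asymp"
begin

text \<open>
  Write \<open>N = n powr (gam \<alpha> * \<alpha>)\<close>; the exponents are such that a summand of size \<open>y n\<^sup>\<gamma>\<close> and a Gaussian
  fluctuation of size \<open>u n\<^sup>\<gamma>\<close> cost \<open>N y\<^sup>\<alpha>\<close> and \<open>N u\<^sup>2 / (2 \<sigma>\<^sup>2)\<close>. It suffices to bound
  the probabilities of \<open>{M\<^sub>n / n\<^sup>\<gamma> \<in> A, S\<^sub>n = v}\<close>; the conditional law is a quotient of two of them.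

  Upper bound: weight each summand above \<open>\<delta> n\<^sup>\<gamma>\<close> by \<open>exp ((1 - \<eta>) X\<^sup>\<alpha>)\<close> and tilt the others by
  \<open>exp (l n powr (\<gamma> - 1) (X - \<mu>))\<close>. The product of the weights has expectation at most
  \<open>exp (N (l\<^sup>2 \<sigma>\<^sup>2 / 2 + o(1)))\<close>, while on the event, for some slope \<open>l\<close> in a fixed finite grid, it is at least
  \<open>exp (N (l\<^sup>2 \<sigma>\<^sup>2 / 2 + inf f - o(1)))\<close>, because the sorted large summands are a competitor in the definition
  of \<open>f\<close>. Markov's inequality concludes.

  Lower bound: prescribe finitely many large summands along a near-optimal sequence, let the central limit theorem,
  applied in roughly \<open>N / T\<^sup>2\<close> independent blocks, produce the Gaussian part, and use one further summand to hit the
  sum exactly.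
\<close>

section \<open>The rate function\<close>

text \<open>Both weights of the upper bound sit at the edge of integrability.
  \<open>exp (X powr \<alpha>)\<close> has infinite expectation, hence the loss \<eta>. So has a
  linear tilt of positive slope, because \<alpha> < 1; but below the threshold
  \<open>\<delta> n\<^sup>\<gamma>\<close> it is dominated by
  \<open>exp (X powr \<alpha> / 2)\<close> once \<delta> is small, and one \<delta> serves all
  slopes in a bounded set. The optimal slope depends on the sum of the large summands, which is
  random; a finite grid replaces it, and its cardinality is negligible on the scale
  \<open>N\<close>. Summands below the threshold leave no trace in the competitor, so the case of a
  small maximum needs control of \<open>f\<close> near 0. In the lower bound, the central limit
  theorem reaches neither deviations of order \<open>n\<^sup>\<gamma>\<close>, which exceed
  \<open>sqrt n\<close>, nor single values of the sum: blocks repair the first defect, the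
  corrective summand the second. The parameter \<open>T\<close> is large but fixed. Wide windows
  make the Gaussian prefactor harmless, and the entries left over by the division into blocks, set
  to zero, cost little per unit of \<open>N\<close>.\<close>

definition F_real :: "real \<Rightarrow> real \<Rightarrow> real \<Rightarrow> (nat \<Rightarrow> real) \<Rightarrow> real" where
  "F_real \<alpha> \<sigma> s x = (\<Sum>j. x j powr \<alpha>) + (s - (\<Sum>j. x j))\<^sup>2 / (2 * \<sigma>\<^sup>2)"

lemma f_fun_le:
  assumes "x \<in> dec_seqs" "x 0 = y" "summable (\<lambda>j. x j powr \<alpha>)" "summable x"
  shows "f_fun \<alpha> \<sigma> s y \<le> F_real \<alpha> \<sigma> s x"
proof -
  have "0 \<le> y"
    using assms by (auto simp: dec_seqs_def)
  then have "ereal (f_fun \<alpha> \<sigma> s y) \<le> F_fun \<alpha> \<sigma> s x"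
    unfolding ereal_f_fun[OF \<open>0 \<le> y\<close>] using assms by (intro INF_lower) auto
  then show ?thesis
    using assms by (simp add: F_fun_def F_real_def)
qed

lemma f_fun_approx:
  assumes "0 \<le> y" "f_fun \<alpha> \<sigma> s y < C"
  obtains x where "x \<in> dec_seqs" "x 0 = y" "summable (\<lambda>j. x j powr \<alpha>)" "summable x"
    "F_real \<alpha> \<sigma> s x < C"
proof -
  have "(INF x\<in>{x\<in>dec_seqs. x 0 = y}. F_fun \<alpha> \<sigma> s x) < ereal C"
    using assms by (simp flip: ereal_f_fun)
  then obtain x where x: "x \<in> dec_seqs" "x 0 = y" "F_fun \<alpha> \<sigma> s x < ereal C"
    by (auto simp: INF_less_iff)
  then show thesis
    using that[of x] by (auto simp: F_fun_def F_real_def split: if_splits)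
qed

lemma f_fun_nonneg:
  assumes "0 \<le> y"
  shows "0 \<le> f_fun \<alpha> \<sigma> s y"
proof -
  have "ereal 0 \<le> ereal (f_fun \<alpha> \<sigma> s y)"
    unfolding ereal_f_fun[OF assms] by (intro INF_greatest) (simp add: F_fun_nonneg flip: zero_ereal_def)
  then show ?thesis
    by simp
qed

text \<open>Coercivity: the head of a competitor alone costs \<open>y powr \<alpha>\<close>. This
  bounds the level sets.\<close>

lemma powr_le_f_fun:
  assumes "0 \<le> y"
  shows "y powr \<alpha> \<le> f_fun \<alpha> \<sigma> s y"
proof (rule ccontr)
  assume "\<not> ?thesis"
  then have "f_fun \<alpha> \<sigma> s y < y powr \<alpha>"
    by simp
  then obtain x where x: "x 0 = y" "summable (\<lambda>j. x j powr \<alpha>)" "F_real \<alpha> \<sigma> s x < y powr \<alpha>"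
    by (elim f_fun_approx[OF assms])
  have "y powr \<alpha> \<le> (\<Sum>j. x j powr \<alpha>)"
    using sum_le_suminf[OF x(2), of "{0}"] x(1) by simp
  moreover have "0 \<le> (s - (\<Sum>j. x j))\<^sup>2 / (2 * \<sigma>\<^sup>2)"
    by simp
  ultimately show False
    using x unfolding F_real_def by linarith
qed

text \<open>By homogeneity one may divide by \<open>a + b\<close>; on the unit interval
  \<open>z \<le> z powr p\<close>.\<close>

lemma powr_add_le:
  fixes a b :: real
  assumes "0 \<le> a" "0 \<le> b" "0 < p" "p \<le> 1"
  shows "(a + b) powr p \<le> a powr p + b powr p"
proof (cases "a + b = 0")
  case False
  then have pos: "0 < a + b"
    using assms by simp
  have le: "z \<le> z powr p" if "0 \<le> z" "z \<le> 1" for z :: real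
    using powr_mono'[of p 1 z] that assms by simp
  have "1 = a / (a + b) + b / (a + b)"
    using pos by (simp flip: add_divide_distrib)
  also have "\<dots> \<le> (a / (a + b)) powr p + (b / (a + b)) powr p"
    using assms pos by (intro add_mono le) auto
  also have "\<dots> = (a powr p + b powr p) / (a + b) powr p"
    using assms pos by (simp add: powr_divide add_divide_distrib)
  finally show ?thesis
    using pos by (simp add: field_simps)
qed (use assms in auto)

text \<open>Turns a bound on the total cost of the large summands into a bound on their sum.\<close>

lemma sum_powr_le:
  fixes g :: "'b \<Rightarrow> real"
  assumes "finite B" "\<And>i. i \<in> B \<Longrightarrow> 0 \<le> g i" "0 < p" "p \<le> 1"
  shows "(\<Sum>i\<in>B. g i) powr p \<le> (\<Sum>i\<in>B. g i powr p)"
  using assms(1,2)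
proof (induction B rule: finite_induct)
  case (insert x B)
  have "(g x + sum g B) powr p \<le> g x powr p + sum g B powr p"
    using insert assms by (intro powr_add_le sum_nonneg) auto
  with insert show ?case
    by auto
qed auto

text \<open>Capping the tail at the new head \<open>y\<close> keeps the sequence decreasing; the mass lost is controlled uniformly
  down to \<open>y = 0\<close> because \<open>x j - y \<le> d powr (1 - \<alpha>) * x j powr \<alpha>\<close> whenever \<open>y < x j\<close>.\<close>

lemma F_real_replace_head:
  fixes \<alpha> \<sigma> s y :: real
  assumes \<alpha>: "0 < \<alpha>" "\<alpha> < 1" and y: "0 \<le> y"
    and x: "x \<in> dec_seqs" "summable (\<lambda>j. x j powr \<alpha>)" "summable x"
  defines "d \<equiv> \<bar>y - x 0\<bar>"
  defines "D \<equiv> d + d powr (1 - \<alpha>) * F_real \<alpha> \<sigma> s x"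
  shows "f_fun \<alpha> \<sigma> s y \<le> F_real \<alpha> \<sigma> s x + d powr \<alpha>
           + (2 * D * \<bar>s - (\<Sum>j. x j)\<bar> + D\<^sup>2) / (2 * \<sigma>\<^sup>2)"
proof -
  define z where "z = (\<lambda>j. if j = 0 then y else min (x j) y)"
  have dec: "x j \<le> x i" if "i \<le> j" for i j
    using x that by (auto simp: dec_seqs_def decseq_def)
  have nn: "0 \<le> x j" for j
    using x by (auto simp: dec_seqs_def)
  have z_nn: "0 \<le> z j" for j
    using nn y by (auto simp: z_def)
  have "z \<in> dec_seqs"
    using z_nn dec by (auto simp: dec_seqs_def decseq_def z_def min_def) (metis order_trans)
  have d0: "0 \<le> d"
    by (simp add: d_def)
  have z_le: "z j powr \<alpha> \<le> x j powr \<alpha> + (if j = 0 then d powr \<alpha> else 0)" for j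
  proof (cases "j = 0")
    case True
    have "y powr \<alpha> \<le> (x 0 + d) powr \<alpha>"
      using y nn \<alpha> by (intro powr_mono2) (auto simp: d_def)
    also have "\<dots> \<le> x 0 powr \<alpha> + d powr \<alpha>"
      using nn d0 \<alpha> by (intro powr_add_le) auto
    finally show ?thesis
      using True by (simp add: z_def)
  next
    case False
    then show ?thesis
      using nn y \<alpha> by (auto simp: z_def intro!: powr_mono2)
  qed
  have diff: "\<bar>z j - x j\<bar> \<le> (if j = 0 then d else 0) + d powr (1 - \<alpha>) * x j powr \<alpha>" for j
  proof (cases "j = 0")
    case True
    then show ?thesis
      using d0 by (simp add: z_def d_def)
  next
    case False
    show ?thesis
    proof (cases "x j \<le> y")
      case True
      then show ?thesis
        using False by (simp add: z_def)
    next
      case xy: False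
      have "\<bar>z j - x j\<bar> = x j - y"
        using False xy by (simp add: z_def)
      \<comment> \<open>The first factor is at most \<open>d powr (1 - \<alpha>)\<close> because
        \<open>x j \<le> x 0\<close>; the second is dominated by a term of the convergent cost
        series.\<close>
      also have "\<dots> = (x j - y) powr (1 - \<alpha>) * (x j - y) powr \<alpha>"
        using xy by (simp flip: powr_add)
      also have "\<dots> \<le> d powr (1 - \<alpha>) * x j powr \<alpha>"
        using xy y \<alpha> dec[of 0 j] by (intro mult_mono powr_mono2) (auto simp: d_def)
      finally show ?thesis
        using False by simp
    qed
  qed
  have sd: "(\<lambda>j. if j = 0 then c else (0::real)) sums c" for c
    using sums_single[of 0 "\<lambda>_. c"] by simp
  have sz: "summable (\<lambda>j. z j powr \<alpha>)"
    by (rule summable_comparison_test'[OF summable_add[OF x(2) sums_summable[OF sd[of "d powr \<alpha>"]]], of 0])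
      (use z_le in auto)
  have Sz: "(\<Sum>j. z j powr \<alpha>) \<le> (\<Sum>j. x j powr \<alpha>) + d powr \<alpha>"
    using suminf_le[OF z_le sz summable_add[OF x(2) sums_summable[OF sd]]]
      sums_unique[OF sums_add[OF summable_sums[OF x(2)] sd[of "d powr \<alpha>"]]] by simp
  have bs: "(\<lambda>j. (if j = 0 then d else 0) + d powr (1 - \<alpha>) * x j powr \<alpha>)
      sums (d + d powr (1 - \<alpha>) * (\<Sum>j. x j powr \<alpha>))"
    by (intro sums_add sd sums_mult summable_sums x)
  have sabs: "summable (\<lambda>j. \<bar>z j - x j\<bar>)"
    by (rule summable_comparison_test'[OF sums_summable[OF bs], of 0]) (use diff in auto)
  have szx: "summable (\<lambda>j. z j - x j)"
    using sabs by (rule summable_rabs_cancel)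
  have sz': "summable z"
    using summable_add[OF szx x(3)] by simp
  have F0: "(\<Sum>j. x j powr \<alpha>) \<le> F_real \<alpha> \<sigma> s x"
    by (simp add: F_real_def)
  have "\<bar>(\<Sum>j. z j) - (\<Sum>j. x j)\<bar> = \<bar>\<Sum>j. z j - x j\<bar>"
    using sz' x by (simp add: suminf_diff)
  also have "\<dots> \<le> (\<Sum>j. \<bar>z j - x j\<bar>)"
    by (rule summable_rabs[OF sabs])
  also have "\<dots> \<le> d + d powr (1 - \<alpha>) * (\<Sum>j. x j powr \<alpha>)"
    using suminf_le[OF diff sabs sums_summable[OF bs]] sums_unique[OF bs] by simp
  also have "\<dots> \<le> D"
    unfolding D_def using F0 by (simp add: mult_left_mono)
  finally have D: "\<bar>(\<Sum>j. z j) - (\<Sum>j. x j)\<bar> \<le> D" .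
  define a where "a = s - (\<Sum>j. x j)"
  define b where "b = (\<Sum>j. x j) - (\<Sum>j. z j)"
  have "(s - (\<Sum>j. z j))\<^sup>2 = (a + b)\<^sup>2"
    by (simp add: a_def b_def)
  also have "\<dots> = a\<^sup>2 + 2 * (a * b) + b\<^sup>2"
    by (simp add: power2_sum)
  also have "\<dots> \<le> a\<^sup>2 + 2 * (D * \<bar>a\<bar>) + D\<^sup>2"
  proof -
    have bD: "\<bar>b\<bar> \<le> D"
      using D by (simp add: b_def)
    have "a * b \<le> \<bar>a\<bar> * \<bar>b\<bar>"
      by (simp flip: abs_mult)
    also have "\<dots> \<le> D * \<bar>a\<bar>"
      using bD by (subst mult.commute) (rule mult_right_mono, auto)
    finally show ?thesis
      using power_mono[OF bD, of 2] by simp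
  qed
  finally have "(s - (\<Sum>j. z j))\<^sup>2 \<le> a\<^sup>2 + (2 * D * \<bar>a\<bar> + D\<^sup>2)"
    by simp
  then have "(s - (\<Sum>j. z j))\<^sup>2 / (2 * \<sigma>\<^sup>2) \<le> a\<^sup>2 / (2 * \<sigma>\<^sup>2) + (2 * D * \<bar>a\<bar> + D\<^sup>2) / (2 * \<sigma>\<^sup>2)"
    by (metis add_divide_distrib divide_right_mono zero_le_power2 mult_nonneg_nonneg zero_le_numeral)
  with Sz have "F_real \<alpha> \<sigma> s z \<le> F_real \<alpha> \<sigma> s x + d powr \<alpha> + (2 * D * \<bar>a\<bar> + D\<^sup>2) / (2 * \<sigma>\<^sup>2)"
    by (simp add: F_real_def a_def)
  moreover have "f_fun \<alpha> \<sigma> s y \<le> F_real \<alpha> \<sigma> s z"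
    using \<open>z \<in> dec_seqs\<close> sz sz' by (intro f_fun_le) (auto simp: z_def)
  ultimately show ?thesis
    by (simp add: a_def)
qed

lemma abs_suminf_le_F_real:
  assumes "F_real \<alpha> \<sigma> s x < C" "\<sigma> \<noteq> 0" "summable (\<lambda>j. x j powr \<alpha>)"
  shows "\<bar>s - (\<Sum>j. x j)\<bar> \<le> sqrt (2 * \<sigma>\<^sup>2 * C)"
proof -
  have "0 \<le> (\<Sum>j. x j powr \<alpha>)"
    using assms by (intro suminf_nonneg) auto
  then have "(s - (\<Sum>j. x j))\<^sup>2 / (2 * \<sigma>\<^sup>2) \<le> C"
    using assms by (simp add: F_real_def)
  then have "(s - (\<Sum>j. x j))\<^sup>2 \<le> 2 * \<sigma>\<^sup>2 * C"
    using assms by (simp add: field_simps)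
  then show ?thesis
    by (metis real_sqrt_abs real_sqrt_le_mono)
qed

lemma tendsto_powr_0_at_right:
  assumes "0 < a"
  shows "((\<lambda>d. d powr a) \<longlongrightarrow> (0::real)) (at_right 0)"
proof -
  have "((\<lambda>d. d powr a) \<longlongrightarrow> 0 powr a) (at_right (0::real))"
    using assms by (intro tendsto_powr') (auto simp: eventually_at_filter)
  then show ?thesis
    by simp
qed

text \<open>The modulus \<open>d0\<close> is valid on a whole sublevel set, because a bound on the
  cost controls the displaced mass and, through \<open>abs_suminf_le_F_real\<close>, the cross term
  of the square. The one-sided form serves closedness of level sets and the comparison of a small
  maximum with 0.\<close>

lemma f_fun_stable:
  assumes \<alpha>: "0 < \<alpha>" "\<alpha> < 1" and \<sigma>: "\<sigma> \<noteq> 0" and \<kappa>: "0 < \<kappa>"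
  obtains d0 where "0 < d0"
    "\<And>y y'. 0 \<le> y \<Longrightarrow> 0 \<le> y' \<Longrightarrow> \<bar>y - y'\<bar> < d0 \<Longrightarrow> f_fun \<alpha> \<sigma> s y' < C
       \<Longrightarrow> f_fun \<alpha> \<sigma> s y \<le> f_fun \<alpha> \<sigma> s y' + \<kappa>"
proof -
  \<comment> \<open>The error in \<open>F_real_replace_head\<close> with the cost replaced by
    \<open>C\<close> and the deviation of the sum by its bound on the sublevel set.\<close>
  define h where "h = (\<lambda>d. d powr \<alpha> + (2 * (d + d powr (1 - \<alpha>) * C) * sqrt (2 * \<sigma>\<^sup>2 * C)
      + (d + d powr (1 - \<alpha>) * C)\<^sup>2) / (2 * \<sigma>\<^sup>2))"
  have "(h \<longlongrightarrow> 0 + (2 * (0 + 0 * C) * sqrt (2 * \<sigma>\<^sup>2 * C) + (0 + 0 * C)\<^sup>2) / (2 * \<sigma>\<^sup>2)) (at_right 0)"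
    unfolding h_def using \<alpha> \<sigma> by (intro tendsto_intros tendsto_powr_0_at_right) auto
  then have "(h \<longlongrightarrow> 0) (at_right 0)"
    by simp
  then have "\<forall>\<^sub>F d in at_right 0. h d < \<kappa>"
    using \<kappa> by (rule order_tendstoD)
  then obtain d1 where d1: "0 < d1" "\<And>d. 0 < d \<Longrightarrow> d < d1 \<Longrightarrow> h d < \<kappa>"
    by (auto simp: eventually_at_right_field)
  show thesis
  proof (rule that[OF d1(1)])
    fix y y' assume y: "0 \<le> y" "0 \<le> y'" "\<bar>y - y'\<bar> < d1" "f_fun \<alpha> \<sigma> s y' < C"
    show "f_fun \<alpha> \<sigma> s y \<le> f_fun \<alpha> \<sigma> s y' + \<kappa>"
    proof (rule field_le_epsilon)
      fix e :: real assume "0 < e"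
      then have "f_fun \<alpha> \<sigma> s y' < min C (f_fun \<alpha> \<sigma> s y' + e)"
        using y by simp
      then obtain x where x: "x \<in> dec_seqs" "x 0 = y'" "summable (\<lambda>j. x j powr \<alpha>)" "summable x"
          "F_real \<alpha> \<sigma> s x < min C (f_fun \<alpha> \<sigma> s y' + e)"
        by (elim f_fun_approx[OF y(2)])
      show "f_fun \<alpha> \<sigma> s y \<le> f_fun \<alpha> \<sigma> s y' + \<kappa> + e"
      proof (cases "y = y'")
        case True
        then show ?thesis
          using \<kappa> \<open>0 < e\<close> by simp
      next
        case False
        define d where "d = \<bar>y - y'\<bar>"
        define D where "D = d + d powr (1 - \<alpha>) * F_real \<alpha> \<sigma> s x"
        have d: "0 < d" "h d < \<kappa>"
          using False y d1 by (auto simp: d_def)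
        have C: "F_real \<alpha> \<sigma> s x < C"
          using x by simp
        have F0: "0 \<le> F_real \<alpha> \<sigma> s x"
          using x by (auto simp: F_real_def intro!: add_nonneg_nonneg suminf_nonneg)
        have D: "0 \<le> D" "D \<le> d + d powr (1 - \<alpha>) * C"
          using d F0 C unfolding D_def by (auto intro!: add_nonneg_nonneg mult_left_mono)
        have "f_fun \<alpha> \<sigma> s y \<le> F_real \<alpha> \<sigma> s x + d powr \<alpha>
           + (2 * D * \<bar>s - (\<Sum>j. x j)\<bar> + D\<^sup>2) / (2 * \<sigma>\<^sup>2)"
          using F_real_replace_head[OF \<alpha> y(1) x(1,3,4), of \<sigma> s] x by (simp add: d_def D_def)
        also have "(2 * D * \<bar>s - (\<Sum>j. x j)\<bar> + D\<^sup>2) / (2 * \<sigma>\<^sup>2)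
            \<le> (2 * (d + d powr (1 - \<alpha>) * C) * sqrt (2 * \<sigma>\<^sup>2 * C) + (d + d powr (1 - \<alpha>) * C)\<^sup>2) / (2 * \<sigma>\<^sup>2)"
          using abs_suminf_le_F_real[OF C \<sigma> x(3)] D d
          by (intro divide_right_mono add_mono mult_mono power_mono) auto
        finally have "f_fun \<alpha> \<sigma> s y \<le> F_real \<alpha> \<sigma> s x + h d"
          by (simp add: h_def)
        then show ?thesis
          using d x by simp
      qed
    qed
  qed
qed

lemma closed_f_fun_level:
  assumes \<alpha>: "0 < \<alpha>" "\<alpha> < 1" and \<sigma>: "\<sigma> \<noteq> 0"
  shows "closed {y \<in> {0..}. f_fun \<alpha> \<sigma> s y \<le> r}"
  unfolding closed_sequential_limits
proof (intro allI impI, elim conjE)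
  fix y l assume y: "\<forall>n. y n \<in> {y \<in> {0..}. f_fun \<alpha> \<sigma> s y \<le> r}" "y \<longlonglongrightarrow> l"
  then have l: "0 \<le> l"
    by (intro LIMSEQ_le_const) auto
  have "f_fun \<alpha> \<sigma> s l \<le> r"
  proof (rule field_le_epsilon)
    fix e :: real assume "0 < e"
    obtain d0 where d0: "0 < d0" "\<And>y y'. 0 \<le> y \<Longrightarrow> 0 \<le> y' \<Longrightarrow> \<bar>y - y'\<bar> < d0
        \<Longrightarrow> f_fun \<alpha> \<sigma> s y' < r + 1 \<Longrightarrow> f_fun \<alpha> \<sigma> s y \<le> f_fun \<alpha> \<sigma> s y' + e"
      using f_fun_stable[OF \<alpha> \<sigma> \<open>0 < e\<close>] by metis
    obtain n where "\<bar>y n - l\<bar> < d0"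
      using LIMSEQ_D[OF y(2) d0(1)] by auto
    moreover have yn: "0 \<le> y n" "f_fun \<alpha> \<sigma> s (y n) \<le> r"
      using y by auto
    ultimately have "f_fun \<alpha> \<sigma> s l \<le> f_fun \<alpha> \<sigma> s (y n) + e"
      using l by (intro d0) auto
    with yn show "f_fun \<alpha> \<sigma> s l \<le> r + e"
      by simp
  qed
  with l show "l \<in> {y \<in> {0..}. f_fun \<alpha> \<sigma> s y \<le> r}"
    by simp
qed

lemma compact_f_fun_level:
  assumes \<alpha>: "0 < \<alpha>" "\<alpha> < 1" and \<sigma>: "\<sigma> \<noteq> 0"
  shows "compact {y \<in> {0..}. f_fun \<alpha> \<sigma> s y \<le> r}"
proof -
  have "{y \<in> {0..}. f_fun \<alpha> \<sigma> s y \<le> r} \<subseteq> {0..max 0 r powr (1 / \<alpha>)}"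
  proof safe
    fix y :: real assume y: "0 \<le> y" "f_fun \<alpha> \<sigma> s y \<le> r"
    then have "(y powr \<alpha>) powr (1 / \<alpha>) \<le> max 0 r powr (1 / \<alpha>)"
      using powr_le_f_fun[OF y(1), of \<alpha> \<sigma> s] \<alpha> by (intro powr_mono2) auto
    then show "y \<in> {0..max 0 r powr (1 / \<alpha>)}"
      using y \<alpha> by (simp add: powr_powr)
  qed
  then show ?thesis
    using closed_f_fun_level[OF assms, of s r] bounded_subset[OF bounded_closed_interval]
    by (auto simp: compact_eq_bounded_closed)
qed

lemma good_rate_function_f_fun:
  assumes \<alpha>: "0 < \<alpha>" "\<alpha> < 1" and \<sigma>: "\<sigma> \<noteq> 0"
  shows "good_rate_function_on {0..} (\<lambda>y. ereal (f_fun \<alpha> \<sigma> s y - (INF z\<in>{0..}. f_fun \<alpha> \<sigma> s z)))"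
proof -
  define m where "m = (INF z\<in>{0..}. f_fun \<alpha> \<sigma> s z)"
  have bdd: "bdd_below (f_fun \<alpha> \<sigma> s ` {0..})"
    by (rule bdd_belowI2[of _ 0]) (simp add: f_fun_nonneg)
  have level: "{y \<in> {0..}. ereal (f_fun \<alpha> \<sigma> s y - m) \<le> ereal r} = {y \<in> {0..}. f_fun \<alpha> \<sigma> s y \<le> r + m}" for r
    by auto
  have "ereal (f_fun \<alpha> \<sigma> s y - m) \<le> Liminf (at y within {0..}) (\<lambda>y. ereal (f_fun \<alpha> \<sigma> s y - m))"
    if "0 \<le> y" for y
    unfolding le_Liminf_iff
  proof (intro allI impI)
    fix C assume C: "C < ereal (f_fun \<alpha> \<sigma> s y - m)"
    then obtain r where r: "C < ereal r" "r < f_fun \<alpha> \<sigma> s y - m"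
      using ereal_dense2[OF C] by auto
    \<comment> \<open>Lower semicontinuity at \<open>y\<close> comes from closedness of the level
      sets: the complement is an open neighbourhood of \<open>y\<close>.\<close>
    have "open (- {y \<in> {0..}. f_fun \<alpha> \<sigma> s y \<le> r + m})" "y \<in> - {y \<in> {0..}. f_fun \<alpha> \<sigma> s y \<le> r + m}"
      using closed_f_fun_level[OF assms] r by auto
    then have "\<forall>\<^sub>F z in at y within {0..}. z \<in> - {y \<in> {0..}. f_fun \<alpha> \<sigma> s y \<le> r + m} \<and> z \<in> {0..}"
      by (intro eventually_conj eventually_at_topological[THEN iffD2])
        (auto simp: eventually_at_topological)
    then show "\<forall>\<^sub>F z in at y within {0..}. C < ereal (f_fun \<alpha> \<sigma> s z - m)"
      by eventually_elim (use r in \<open>auto elim!: less_trans\<close>)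
  qed
  moreover have "0 \<le> f_fun \<alpha> \<sigma> s y - m" if "0 \<le> y" for y
    using that bdd by (auto simp: m_def intro!: cINF_lower)
  ultimately show ?thesis
    unfolding good_rate_function_on_def lower_semicontinuous_on_def m_def[symmetric] level
    by (intro conjI ballI allI compact_f_fun_level[OF assms]) (simp_all only: atLeast_iff ereal_less_eq zero_ereal_def)
qed

text \<open>An arbitrary finite index set fits the later use, where \<open>B\<close> is the set of
  indices of large summands and \<open>b\<close> the index of a maximal one.\<close>

lemma f_fun_le_finite:
  fixes g :: "'b \<Rightarrow> real"
  assumes "finite B" "b \<in> B" "\<And>i. i \<in> B \<Longrightarrow> 0 \<le> g i" "\<And>i. i \<in> B \<Longrightarrow> g i \<le> g b"
  shows "f_fun \<alpha> \<sigma> s (g b) \<le> (\<Sum>i\<in>B. g i powr \<alpha>) + (s - (\<Sum>i\<in>B. g i))\<^sup>2 / (2 * \<sigma>\<^sup>2)"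
proof -
  obtain l0 where l0: "set l0 = B" "distinct l0"
    using assms finite_distinct_list by blast
  define l where "l = rev (sort_key g l0)"
  have l: "set l = B" "distinct l" "sorted (map g (rev l))"
    by (auto simp: l_def l0)
  \<comment> \<open>Padding with zeros adds neither cost nor mass, as
    \<open>0 powr \<alpha> = 0\<close>.\<close>
  define x where "x = (\<lambda>j. if j < length l then g (l ! j) else 0)"
  have nth: "g (l ! j) \<le> g (l ! i)" if "i \<le> j" "j < length l" for i j
    using l(3) that unfolding rev_map[symmetric] sorted_rev_iff_nth_mono by auto
  have "x \<in> dec_seqs"
    using assms l nth by (auto simp: dec_seqs_def decseq_def x_def)
  moreover have "x 0 = g b"
  proof -
    obtain i where "i < length l" "l ! i = b"
      using l assms by (metis in_set_conv_nth)
    then show ?thesis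
      using nth[of 0 i] assms l by (auto simp: x_def intro!: antisym)
  qed
  moreover have sums: "(\<lambda>j. h (x j)) sums (\<Sum>i\<in>B. h (g i))" if "h 0 = 0" for h :: "real \<Rightarrow> real"
  proof -
    have "(\<lambda>j. h (x j)) sums (\<Sum>j<length l. h (x j))"
      using that by (intro sums_finite) (auto simp: x_def)
    also have "(\<Sum>j<length l. h (x j)) = (\<Sum>i\<in>B. h (g i))"
      using bij_betw_nth[OF l(2) refl l(1)[symmetric]]
      by (subst sum.reindex_bij_betw[symmetric, where h = "\<lambda>j. l ! j" and S = "{..<length l}"])
        (auto simp: x_def)
    finally show ?thesis .
  qed
  ultimately have "f_fun \<alpha> \<sigma> s (g b) \<le> F_real \<alpha> \<sigma> s x"
    using sums[of "\<lambda>z. z powr \<alpha>"] sums[of "\<lambda>z. z"]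
    by (intro f_fun_le) (auto simp: sums_iff)
  then show ?thesis
    using sums[of "\<lambda>z. z powr \<alpha>"] sums[of "\<lambda>z. z"] by (simp add: F_real_def sums_iff)
qed

section \<open>The upper bound\<close>

text \<open>The identity balances the cost \<open>(n\<^sup>\<gamma>) powr \<alpha>\<close> of one
  jump against the cost \<open>(n\<^sup>\<gamma>)\<^sup>2 / n\<close> of a Gaussian fluctuation of
  the same size. The bounds place \<open>n\<^sup>\<gamma>\<close> strictly between
  \<open>sqrt n\<close> and \<open>n\<close>.\<close>

lemma gam_bounds:
  assumes "0 < \<alpha>" "\<alpha> < 1"
  shows "1/2 < gam \<alpha>" "gam \<alpha> < 1" "gam \<alpha> * \<alpha> = 2 * gam \<alpha> - 1"
  using assms by (auto simp: gam_def field_simps)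

text \<open>One family covers all moments below: the cube stems from the Taylor remainder, and
  \<eta> is the part of the tail exponent that survives a weight
  \<open>exp ((1 - \<eta>) * real k powr \<alpha>)\<close>.\<close>

lemma summable_stretched_exp:
  fixes \<alpha> \<eta> m :: real
  assumes "0 < \<alpha>" "0 < \<eta>"
  shows "summable (\<lambda>k::nat. (real k + m) ^ 3 * exp (- (\<eta> * real k powr \<alpha>)))"
proof (rule summable_comparison_test_bigo)
  show "summable (\<lambda>k. norm (real k powr (-2)))"
    by (simp add: summable_real_powr_iff)
  show "(\<lambda>k::nat. (real k + m) ^ 3 * exp (- (\<eta> * real k powr \<alpha>))) \<in> O(\<lambda>k. real k powr (-2))"
    using assms by real_asymp
qed

lemma norm_const_pos:
  assumes "0 < \<alpha>"
  shows "0 < norm_const \<alpha>"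
proof -
  have "summable (\<lambda>k::nat. exp (- (real k powr \<alpha>)))"
    by (rule summable_comparison_test'[OF summable_stretched_exp[OF assms zero_less_one, of 1]]) simp
  then show ?thesis
    by (simp add: norm_const_def suminf_pos)
qed

section \<open>Pointwise bounds for one factor of the exponential functional\<close>

lemma exp_le_quadratic_plus_cubic:
  fixes z :: real
  shows "exp z \<le> 1 + z + z\<^sup>2 / 2 + \<bar>z\<bar> ^ 3 * exp \<bar>z\<bar>"
proof -
  obtain t where t: "\<bar>t\<bar> \<le> \<bar>z\<bar>" "exp z = (\<Sum>m<3. z ^ m / fact m) + exp t / fact 3 * z ^ 3"
    using Maclaurin_exp_le[of z 3] by auto
  have "exp t / 6 * z ^ 3 \<le> exp \<bar>z\<bar> * \<bar>z\<bar> ^ 3"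
  proof -
    have "exp t / 6 * z ^ 3 \<le> exp t / 6 * \<bar>z\<bar> ^ 3"
      by (intro mult_left_mono) (auto simp flip: power_abs)
    also have "\<dots> \<le> exp \<bar>z\<bar> * \<bar>z\<bar> ^ 3"
    proof (rule mult_right_mono)
      have "exp t \<le> exp \<bar>z\<bar>"
        using t(1) by simp
      then show "exp t / 6 \<le> exp \<bar>z\<bar>"
        using exp_gt_zero[of t] by linarith
    qed simp
    finally show ?thesis .
  qed
  then show ?thesis
    using t(2) by (simp add: eval_nat_numeral mult.commute)
qed

definition stretched_prob :: "real \<Rightarrow> nat \<Rightarrow> real" where
  "stretched_prob \<alpha> k = norm_const \<alpha> * exp (- (real k powr \<alpha>))"

text \<open>A single factor of the exponential functional in the upper bound: a summand above the threshold
  \<open>\<delta> n\<^sup>\<gamma>\<close> is weighted by almost the reciprocal of its probability, the others are tilted as for moderate deviations.\<close>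

definition tilt :: "real \<Rightarrow> real \<Rightarrow> real \<Rightarrow> real \<Rightarrow> real \<Rightarrow> nat \<Rightarrow> nat \<Rightarrow> real" where
  "tilt \<alpha> \<mu> \<eta> \<delta> l n k = (if \<delta> * real n powr gam \<alpha> < real k then exp ((1 - \<eta>) * real k powr \<alpha>)
     else exp (l * real n powr (gam \<alpha> - 1) * (real k - \<mu>)))"

lemma tilt_pos: "0 < tilt \<alpha> \<mu> \<eta> \<delta> l n k"
  by (simp add: tilt_def)

lemmas tilt_nonneg = less_imp_le[OF tilt_pos]

text \<open>Below the threshold this is a third-order Taylor bound, the hypothesis on \<delta>
  keeping the remainder under \<open>exp (real k powr \<alpha> / 2)\<close>. Above it, the indicator
  of \<open>k > \<delta> n\<^sup>\<gamma>\<close> is at most the square of the quotient, as in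
  Chebyshev's inequality. The resulting \<open>n powr (- 2 \<gamma>)\<close> makes the large
  summands negligible even after multiplication by the number \<open>n\<close> of factors.\<close>

lemma tilt_le:
  fixes \<mu> l :: real
  assumes \<alpha>: "0 < \<alpha>" "\<alpha> < 1" and \<delta>: "0 < \<delta>" "\<bar>l\<bar> * \<delta> powr (1 - \<alpha>) \<le> 1/2" and n: "1 \<le> n"
  defines "\<theta> \<equiv> l * real n powr (gam \<alpha> - 1)"
  shows "tilt \<alpha> \<mu> \<eta> \<delta> l n k \<le> 1 + \<theta> * (real k - \<mu>) + \<theta>\<^sup>2 / 2 * (real k - \<mu>)\<^sup>2
     + \<bar>\<theta>\<bar> ^ 3 * (exp (\<bar>l\<bar> * \<bar>\<mu>\<bar>) * ((real k + \<bar>\<mu>\<bar>) ^ 3 * exp (real k powr \<alpha> / 2)))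
     + real n powr (- 2 * gam \<alpha>) * (\<delta> powr (- 2) * (real k ^ 3 * exp ((1 - \<eta>) * real k powr \<alpha>)))"
    (is "_ \<le> ?Q + ?C + ?B")
proof (cases "\<delta> * real n powr gam \<alpha> < real k")
  case True
  \<comment> \<open>Half a sum of two squares, hence harmless as an additional term of the
    bound.\<close>
  have "?Q = ((1 + \<theta> * (real k - \<mu>))\<^sup>2 + 1) / 2"
    by (simp add: power2_sum[of 1] power_mult_distrib)
  then have Q: "0 \<le> ?Q"
    by (simp only:) simp
  have C: "0 \<le> ?C"
    by simp
  have n0: "0 < real n powr gam \<alpha>"
    using n by simp
  have k: "1 \<le> k"
    using True \<delta> n0 by (cases k) (auto simp: mult_less_0_iff)
  have "1 \<le> (real k / (\<delta> * real n powr gam \<alpha>)) ^ 2"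
    using True \<delta> n0 by (intro one_le_power) (simp add: field_simps)
  also have "\<dots> = (\<delta> * real n powr gam \<alpha>) powr (- 2) * real k ^ 2"
    using \<delta> n0 by (simp add: power_divide powr_minus_divide)
  also have "\<dots> = real n powr (- 2 * gam \<alpha>) * (\<delta> powr (- 2) * real k ^ 2)"
    using \<delta> by (simp add: powr_mult powr_powr mult_ac)
  \<comment> \<open>The cube replaces the square so that both error terms are integrable by the same
    lemma, \<open>integrable_X_stretched\<close>.\<close>
  also have "\<dots> \<le> real n powr (- 2 * gam \<alpha>) * (\<delta> powr (- 2) * real k ^ 3)"
    using k by (intro mult_left_mono power_increasing) auto
  finally have "1 * exp ((1 - \<eta>) * real k powr \<alpha>)
      \<le> real n powr (- 2 * gam \<alpha>) * (\<delta> powr (- 2) * real k ^ 3) * exp ((1 - \<eta>) * real k powr \<alpha>)"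
    by (rule mult_right_mono) simp
  then have "exp ((1 - \<eta>) * real k powr \<alpha>) \<le> ?B"
    by (simp add: mult.assoc)
  moreover have "tilt \<alpha> \<mu> \<eta> \<delta> l n k = exp ((1 - \<eta>) * real k powr \<alpha>)"
    using True by (simp add: tilt_def)
  ultimately show ?thesis
    using Q C by linarith
next
  case False
  let ?z = "\<theta> * (real k - \<mu>)"
  \<comment> \<open>Write \<open>k = k powr (1 - \<alpha>) * k powr \<alpha>\<close>. By the choice
    of \<gamma>, \<open>(n\<^sup>\<gamma>) powr (1 - \<alpha>) = n powr (1 - \<gamma>)\<close>,
    which cancels the factor \<open>n powr (\<gamma> - 1)\<close> in \<theta>.\<close>
  have key: "\<bar>\<theta>\<bar> * real k \<le> real k powr \<alpha> / 2"
  proof (cases "k = 0")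
    case False
    have "real k powr (1 - \<alpha>) \<le> (\<delta> * real n powr gam \<alpha>) powr (1 - \<alpha>)"
      using \<open>\<not> \<delta> * real n powr gam \<alpha> < real k\<close> \<alpha> by (intro powr_mono2) auto
    also have "\<dots> = \<delta> powr (1 - \<alpha>) * real n powr (1 - gam \<alpha>)"
      using \<delta> gam_bounds[OF \<alpha>] by (simp add: powr_mult powr_powr right_diff_distrib)
    finally have "real k powr (1 - \<alpha>) * real k powr \<alpha> \<le> \<delta> powr (1 - \<alpha>) * real n powr (1 - gam \<alpha>) * real k powr \<alpha>"
      by (rule mult_right_mono) simp
    moreover have "real k = real k powr (1 - \<alpha>) * real k powr \<alpha>"
      using False by (simp flip: powr_add)
    ultimately have "\<bar>\<theta>\<bar> * real k \<le> \<bar>\<theta>\<bar> * (\<delta> powr (1 - \<alpha>) * real n powr (1 - gam \<alpha>) * real k powr \<alpha>)"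
      by (intro mult_left_mono) auto
    also have "\<dots> = (\<bar>l\<bar> * \<delta> powr (1 - \<alpha>)) * (real n powr (gam \<alpha> - 1) * real n powr (1 - gam \<alpha>)) * real k powr \<alpha>"
      by (simp add: \<theta>_def abs_mult)
    also have "real n powr (gam \<alpha> - 1) * real n powr (1 - gam \<alpha>) = 1"
      using n by (simp flip: powr_add)
    also have "\<bar>l\<bar> * \<delta> powr (1 - \<alpha>) * 1 * real k powr \<alpha> \<le> 1/2 * real k powr \<alpha>"
      using \<delta> by (intro mult_right_mono) auto
    finally show ?thesis
      by simp
  qed auto
  have "real n powr (gam \<alpha> - 1) \<le> 1"
    using powr_mono[of "gam \<alpha> - 1" 0 "real n"] n gam_bounds[OF \<alpha>] by simp
  then have \<theta>l: "\<bar>\<theta>\<bar> \<le> \<bar>l\<bar>"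
    by (simp add: \<theta>_def abs_mult mult_left_le)
  have kmu: "\<bar>real k - \<mu>\<bar> \<le> real k + \<bar>\<mu>\<bar>"
    by simp
  have "\<bar>?z\<bar> \<le> \<bar>\<theta>\<bar> * real k + \<bar>\<theta>\<bar> * \<bar>\<mu>\<bar>"
    using mult_left_mono[OF kmu, of "\<bar>\<theta>\<bar>"] by (simp add: abs_mult distrib_left)
  also have "\<dots> \<le> real k powr \<alpha> / 2 + \<bar>l\<bar> * \<bar>\<mu>\<bar>"
    using key \<theta>l by (intro add_mono mult_right_mono) auto
  finally have e: "exp \<bar>?z\<bar> \<le> exp (\<bar>l\<bar> * \<bar>\<mu>\<bar>) * exp (real k powr \<alpha> / 2)"
    by (simp add: add.commute flip: exp_add)
  have "\<bar>?z\<bar> ^ 3 \<le> \<bar>\<theta>\<bar> ^ 3 * (real k + \<bar>\<mu>\<bar>) ^ 3"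
    using power_mono[OF kmu, of 3] by (simp add: abs_mult power_mult_distrib mult_left_mono)
  then have "\<bar>?z\<bar> ^ 3 * exp \<bar>?z\<bar> \<le> (\<bar>\<theta>\<bar> ^ 3 * (real k + \<bar>\<mu>\<bar>) ^ 3) * (exp (\<bar>l\<bar> * \<bar>\<mu>\<bar>) * exp (real k powr \<alpha> / 2))"
    using e by (intro mult_mono) auto
  also have "\<dots> = ?C"
    by (simp add: mult_ac)
  finally have "exp ?z \<le> ?Q + ?C"
    using exp_le_quadratic_plus_cubic[of ?z] by (simp add: power_mult_distrib)
  moreover have "0 \<le> ?B"
    by simp
  ultimately have "exp ?z \<le> ?Q + ?C + ?B"
    by linarith
  moreover have "tilt \<alpha> \<mu> \<eta> \<delta> l n k = exp ?z"
    using False by (simp add: tilt_def \<theta>_def)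
  ultimately show ?thesis
    by simp
qed

section \<open>The i.i.d. setting: laws, integrability, moments and the exponential
  functional\<close>

locale stretched_iid = prob_space M
  for M :: "'a measure" +
  fixes X :: "nat \<Rightarrow> 'a \<Rightarrow> nat" and \<alpha> \<mu> \<sigma> :: real
  assumes \<alpha>: "0 < \<alpha>" "\<alpha> < 1"
    and indep: "indep_vars (\<lambda>_. count_space UNIV) X {1..}"
    and prob_X: "\<And>i k. 1 \<le> i \<Longrightarrow> prob {\<omega> \<in> space M. X i \<omega> = k} = stretched_prob \<alpha> k"
    and mean_X: "\<And>i. 1 \<le> i \<Longrightarrow> expectation (\<lambda>\<omega>. real (X i \<omega>)) = \<mu>"
    and var_X: "\<And>i. 1 \<le> i \<Longrightarrow> variance (\<lambda>\<omega>. real (X i \<omega>)) = \<sigma>\<^sup>2"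
begin

lemma X_measurable [measurable]: "1 \<le> i \<Longrightarrow> X i \<in> measurable M (count_space UNIV)"
  using indep by (auto simp: indep_vars_def2)

lemma stretched_prob_pos: "0 < stretched_prob \<alpha> k"
  using norm_const_pos[OF \<alpha>(1)] by (simp add: stretched_prob_def)

text \<open>Reduces integrability of functions of \<open>X i\<close> to convergence of series and
  makes it visible that the law does not depend on \<open>i\<close>.\<close>

lemma distr_X:
  assumes "1 \<le> i"
  shows "distr M (count_space UNIV) (X i) = density (count_space UNIV) (\<lambda>k. ennreal (stretched_prob \<alpha> k))"
proof (rule measure_eqI_countable[where A = UNIV])
  fix a :: nat
  have "emeasure (distr M (count_space UNIV) (X i)) {a} = ennreal (prob {\<omega> \<in> space M. X i \<omega> = a})"
    using assms by (subst emeasure_distr) (auto simp: emeasure_eq_measure intro!: arg_cong[where f = prob])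
  also have "\<dots> = emeasure (density (count_space UNIV) (\<lambda>k. ennreal (stretched_prob \<alpha> k))) {a}"
    using assms by (subst emeasure_density) (auto simp: prob_X nn_integral_indicator_singleton)
  finally show "emeasure (distr M (count_space UNIV) (X i)) {a}
      = emeasure (density (count_space UNIV) (\<lambda>k. ennreal (stretched_prob \<alpha> k))) {a}" .
qed auto

lemma integrable_X:
  fixes g :: "nat \<Rightarrow> real"
  assumes i: "1 \<le> i" and g: "summable (\<lambda>k. \<bar>g k\<bar> * exp (- (real k powr \<alpha>)))"
  shows "integrable M (\<lambda>\<omega>. g (X i \<omega>))"
proof -
  have "summable (\<lambda>k. \<bar>stretched_prob \<alpha> k * g k\<bar>)"
    using summable_mult[OF g, of "norm_const \<alpha>"] norm_const_pos[OF \<alpha>(1)]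
    by (simp add: stretched_prob_def abs_mult mult_ac)
  then have "integrable (density (count_space UNIV) (\<lambda>k. ennreal (stretched_prob \<alpha> k))) g"
    using stretched_prob_pos less_imp_le by (subst integrable_density) (auto simp: integrable_count_space_nat_iff)
  then show ?thesis
    using i by (simp add: integrable_distr_eq flip: distr_X[OF i])
qed

lemma expectation_X_eq:
  fixes g :: "nat \<Rightarrow> real"
  assumes "1 \<le> i" "1 \<le> j"
  shows "expectation (\<lambda>\<omega>. g (X i \<omega>)) = expectation (\<lambda>\<omega>. g (X j \<omega>))"
  using integral_distr[of "X i" M "count_space UNIV" g] integral_distr[of "X j" M "count_space UNIV" g] assms
  by (simp add: distr_X)

lemma integrable_X_stretched:
  assumes i: "1 \<le> i" and \<eta>: "\<eta> < 1" and m: "0 \<le> m"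
  shows "integrable M (\<lambda>\<omega>. (real (X i \<omega>) + m) ^ 3 * exp (\<eta> * real (X i \<omega>) powr \<alpha>))"
proof (rule integrable_X[OF i])
  have "0 < 1 - \<eta>"
    using \<eta> by simp
  from summable_stretched_exp[OF \<alpha>(1) this, of m]
  show "summable (\<lambda>k. \<bar>(real k + m) ^ 3 * exp (\<eta> * real k powr \<alpha>)\<bar> * exp (- (real k powr \<alpha>)))"
    using m by (simp add: abs_mult mult.assoc flip: exp_add) (simp add: algebra_simps)
qed

lemma integrable_X_square: "1 \<le> i \<Longrightarrow> integrable M (\<lambda>\<omega>. (real (X i \<omega>))\<^sup>2)"
proof (rule Bochner_Integration.integrable_bound[OF integrable_X_stretched[of i 0 1]])
  assume i: "1 \<le> i"
  have "(real k)\<^sup>2 \<le> (real k + 1) ^ 3" for k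
  proof -
    have "(real k)\<^sup>2 \<le> (real k + 1)\<^sup>2"
      by (intro power_mono) auto
    also have "\<dots> \<le> (real k + 1) ^ 3"
      by (intro power_increasing) auto
    finally show ?thesis .
  qed
  then show "AE \<omega> in M. norm ((real (X i \<omega>))\<^sup>2) \<le> norm ((real (X i \<omega>) + 1) ^ 3 * exp (0 * real (X i \<omega>) powr \<alpha>))"
    by simp
qed auto

lemma integrable_X_id: "1 \<le> i \<Longrightarrow> integrable M (\<lambda>\<omega>. real (X i \<omega>))"
  by (rule square_integrable_imp_integrable[OF _ integrable_X_square]) auto

lemma integrable_X_centered_square: "1 \<le> i \<Longrightarrow> integrable M (\<lambda>\<omega>. (real (X i \<omega>) - \<mu>)\<^sup>2)"
  using integrable_X_square[of i] integrable_X_id[of i] by (simp add: power2_diff)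

lemma expectation_X_centered_square: "1 \<le> i \<Longrightarrow> expectation (\<lambda>\<omega>. (real (X i \<omega>) - \<mu>)\<^sup>2) = \<sigma>\<^sup>2"
  using var_X mean_X by simp

lemma mean_nonneg: "0 \<le> \<mu>"
  using mean_X[of 1] by (metis integral_nonneg_AE AE_I2 of_nat_0_le_iff order_refl)

text \<open>Zero variance would make \<open>X 1\<close> almost surely constant, but 0 and 1 both
  have positive probability.\<close>

lemma sigma_nonzero: "\<sigma> \<noteq> 0"
proof
  assume "\<sigma> = 0"
  then have "expectation (\<lambda>\<omega>. (real (X 1 \<omega>) - \<mu>)\<^sup>2) = 0"
    using expectation_X_centered_square[of 1] by simp
  then have AE: "AE \<omega> in M. real (X 1 \<omega>) = \<mu>"
    using integral_nonneg_eq_0_iff_AE[OF integrable_X_centered_square[of 1]] by auto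
  have "real k = \<mu>" for k
  proof (rule ccontr)
    assume "real k \<noteq> \<mu>"
    with AE have "AE \<omega> in M. \<omega> \<notin> {\<omega> \<in> space M. X 1 \<omega> = k}"
      by (auto elim!: eventually_mono)
    then have "prob {\<omega> \<in> space M. X 1 \<omega> = k} = 0"
      by (intro prob_eq_0[THEN iffD2]) auto
    then show False
      using prob_X[of 1 k] stretched_prob_pos[of k] by simp
  qed
  from this[of 0] this[of 1] show False
    by simp
qed

text \<open>By independence and \<open>1 + b n \<le> exp (b n)\<close>, only the expectation of the
  bound in \<open>tilt_le\<close> matters: centring removes its linear term, and the variance turns
  its quadratic term into the leading one.\<close>

lemma expectation_prod_tilt_le:
  assumes \<delta>: "0 < \<delta>" "\<bar>l\<bar> * \<delta> powr (1 - \<alpha>) \<le> 1/2" and \<eta>: "0 < \<eta>" and \<kappa>: "0 < \<kappa>"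
  shows "\<forall>\<^sub>F n in sequentially. (\<integral>\<^sup>+\<omega>. (\<Prod>i\<in>{1..n}. tilt \<alpha> \<mu> \<eta> \<delta> l n (X i \<omega>)) \<partial>M)
           \<le> ennreal (exp (real n powr (gam \<alpha> * \<alpha>) * (l\<^sup>2 * \<sigma>\<^sup>2 / 2 + \<kappa>)))"
proof -
  define H1 where "H1 k = exp (\<bar>l\<bar> * \<bar>\<mu>\<bar>) * ((real k + \<bar>\<mu>\<bar>) ^ 3 * exp (real k powr \<alpha> / 2))" for k
  define H2 where "H2 k = \<delta> powr (- 2) * (real k ^ 3 * exp ((1 - \<eta>) * real k powr \<alpha>))" for k
  define K1 where "K1 = expectation (\<lambda>\<omega>. H1 (X 1 \<omega>))"
  define K2 where "K2 = expectation (\<lambda>\<omega>. H2 (X 1 \<omega>))"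
  note \<gamma> = gam_bounds[OF \<alpha>]
  define b where "b n = (l * real n powr (gam \<alpha> - 1))\<^sup>2 / 2 * \<sigma>\<^sup>2
      + \<bar>l * real n powr (gam \<alpha> - 1)\<bar> ^ 3 * K1 + real n powr (- 2 * gam \<alpha>) * K2" for n
  have iH1: "integrable M (\<lambda>\<omega>. H1 (X i \<omega>))" if "1 \<le> i" for i
    unfolding H1_def using integrable_X_stretched[OF that, of "1/2" "\<bar>\<mu>\<bar>"] by (intro integrable_mult_right) simp
  have iH2: "integrable M (\<lambda>\<omega>. H2 (X i \<omega>))" if "1 \<le> i" for i
    unfolding H2_def using integrable_X_stretched[OF that, of "1 - \<eta>" 0] \<eta> by (intro integrable_mult_right) simp
  have main: "(\<integral>\<^sup>+\<omega>. (\<Prod>i\<in>{1..n}. tilt \<alpha> \<mu> \<eta> \<delta> l n (X i \<omega>)) \<partial>M) \<le> ennreal (exp (real n * b n))" if n: "1 \<le> n" for n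
  proof -
    define \<theta> where "\<theta> = l * real n powr (gam \<alpha> - 1)"
    have one: "(\<integral>\<^sup>+\<omega>. tilt \<alpha> \<mu> \<eta> \<delta> l n (X i \<omega>) \<partial>M) \<le> ennreal (exp (b n))" if i: "1 \<le> i" for i
    proof -
      define R where "R \<omega> = 1 + \<theta> * (real (X i \<omega>) - \<mu>) + \<theta>\<^sup>2 / 2 * (real (X i \<omega>) - \<mu>)\<^sup>2
          + \<bar>\<theta>\<bar> ^ 3 * H1 (X i \<omega>) + real n powr (- 2 * gam \<alpha>) * H2 (X i \<omega>)" for \<omega>
      have le: "tilt \<alpha> \<mu> \<eta> \<delta> l n (X i \<omega>) \<le> R \<omega>" for \<omega>
        using tilt_le[OF \<alpha> \<delta> n, of \<mu> \<eta> "X i \<omega>"] by (simp add: R_def H1_def H2_def \<theta>_def)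
      have iR: "integrable M R"
        unfolding R_def using i
        by (intro Bochner_Integration.integrable_add integrable_mult_right Bochner_Integration.integrable_diff
            integrable_const iH1 iH2 integrable_X_centered_square integrable_X_id) auto
      have "(\<integral>\<^sup>+\<omega>. tilt \<alpha> \<mu> \<eta> \<delta> l n (X i \<omega>) \<partial>M) \<le> (\<integral>\<^sup>+\<omega>. R \<omega> \<partial>M)"
        using le by (intro nn_integral_mono ennreal_leI) auto
      also have "\<dots> = ennreal (expectation R)"
        using order_trans[OF tilt_nonneg le] by (intro nn_integral_eq_integral[OF iR] AE_I2)
      also have "expectation R = 1 + b n"
      proof (rule has_bochner_integral_integral_eq)
        have "has_bochner_integral M R (1 + \<theta> * (\<mu> - \<mu>) + \<theta>\<^sup>2 / 2 * \<sigma>\<^sup>2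
            + \<bar>\<theta>\<bar> ^ 3 * K1 + real n powr (- 2 * gam \<alpha>) * K2)"
          unfolding R_def
          by (intro has_bochner_integral_add has_bochner_integral_mult_right has_bochner_integral_diff)
            (simp_all add: has_bochner_integral_iff integrable_X_id[OF i] mean_X[OF i] iH1[OF i] iH2[OF i] K1_def K2_def prob_space
              integrable_X_centered_square[OF i] expectation_X_centered_square[OF i]
              expectation_X_eq[OF i, of 1 H1] expectation_X_eq[OF i, of 1 H2])
        then show "has_bochner_integral M R (1 + b n)"
          by (simp add: b_def \<theta>_def add.assoc)
      qed
      also have "ennreal (1 + b n) \<le> ennreal (exp (b n))"
        by (intro ennreal_leI exp_ge_add_one_self)
      finally show ?thesis .
    qed
    have ind: "indep_vars (\<lambda>_. borel) (\<lambda>i \<omega>. ennreal (tilt \<alpha> \<mu> \<eta> \<delta> l n (X i \<omega>))) {1..n}"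
      by (rule indep_vars_compose2[OF indep_vars_subset[OF indep]]) auto
    have "(\<integral>\<^sup>+\<omega>. ennreal (\<Prod>i\<in>{1..n}. tilt \<alpha> \<mu> \<eta> \<delta> l n (X i \<omega>)) \<partial>M)
        = (\<integral>\<^sup>+\<omega>. (\<Prod>i\<in>{1..n}. ennreal (tilt \<alpha> \<mu> \<eta> \<delta> l n (X i \<omega>))) \<partial>M)"
      by (simp add: prod_ennreal tilt_nonneg)
    also have "\<dots> = (\<Prod>i\<in>{1..n}. \<integral>\<^sup>+\<omega>. tilt \<alpha> \<mu> \<eta> \<delta> l n (X i \<omega>) \<partial>M)"
      using ind by (intro indep_vars_nn_integral) auto
    also have "\<dots> \<le> (\<Prod>i\<in>{1..n}. ennreal (exp (b n)))"
      using one by (intro prod_mono_ennreal) auto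
    also have "\<dots> = ennreal (exp (real n * b n))"
      by (simp add: ennreal_power exp_of_nat_mult)
    finally show ?thesis .
  qed
  \<comment> \<open>Relative to the leading order \<open>n powr (2 * \<gamma> - 1)\<close>, the
    Taylor remainder is of order \<open>n powr (\<gamma> - 1)\<close> and the contribution of large
    summands of order \<open>n powr (2 - 4 * \<gamma>)\<close>; both vanish because
    \<open>1/2 < \<gamma> < 1\<close>.\<close>
  have b: "real n * b n = real n powr (gam \<alpha> * \<alpha>) * (l\<^sup>2 * \<sigma>\<^sup>2 / 2
      + (\<bar>l\<bar> ^ 3 * K1 * real n powr (gam \<alpha> - 1) + K2 * real n powr (2 - 4 * gam \<alpha>)))" if "1 \<le> n" for n
  proof -
    have pw: "real n * (real n powr a) = real n powr (1 + a)" for a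
      using that by (simp add: powr_add)
    have "real n * b n = l\<^sup>2 * \<sigma>\<^sup>2 / 2 * (real n * (real n powr (gam \<alpha> - 1))\<^sup>2)
        + \<bar>l\<bar> ^ 3 * K1 * (real n * (real n powr (gam \<alpha> - 1)) ^ 3) + K2 * (real n * real n powr (- 2 * gam \<alpha>))"
      by (simp add: b_def power_mult_distrib abs_mult algebra_simps)
    also have "real n * (real n powr (gam \<alpha> - 1))\<^sup>2 = real n powr (2 * gam \<alpha> - 1)"
      using that by (simp add: powr_power pw algebra_simps)
    also have "real n * (real n powr (gam \<alpha> - 1)) ^ 3 = real n powr (2 * gam \<alpha> - 1) * real n powr (gam \<alpha> - 1)"
      using that by (simp add: powr_power pw algebra_simps flip: powr_add)
    also have "real n * real n powr (- 2 * gam \<alpha>) = real n powr (2 * gam \<alpha> - 1) * real n powr (2 - 4 * gam \<alpha>)"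
      by (simp only: pw powr_add[symmetric]) (simp add: algebra_simps)
    finally show ?thesis
      unfolding \<gamma>(3) by (simp only: algebra_simps)
  qed
  have "(\<lambda>n. real n powr (gam \<alpha> - 1)) \<longlonglongrightarrow> 0" "(\<lambda>n. real n powr (2 - 4 * gam \<alpha>)) \<longlonglongrightarrow> 0"
    using \<gamma> by (auto intro!: tendsto_neg_powr filterlim_real_sequentially)
  then have "(\<lambda>n. \<bar>l\<bar> ^ 3 * K1 * real n powr (gam \<alpha> - 1) + K2 * real n powr (2 - 4 * gam \<alpha>))
      \<longlonglongrightarrow> \<bar>l\<bar> ^ 3 * K1 * 0 + K2 * 0"
    by (intro tendsto_intros)
  then have "\<forall>\<^sub>F n in sequentially. \<bar>l\<bar> ^ 3 * K1 * real n powr (gam \<alpha> - 1) + K2 * real n powr (2 - 4 * gam \<alpha>) < \<kappa>"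
    using \<kappa> by (intro order_tendstoD) auto
  then show ?thesis
    using eventually_ge_at_top[of 1]
  proof eventually_elim
    case (elim n)
    have "real n * b n \<le> real n powr (gam \<alpha> * \<alpha>) * (l\<^sup>2 * \<sigma>\<^sup>2 / 2 + \<kappa>)"
      unfolding b[OF elim(2)] using elim(1) by (intro mult_left_mono) auto
    then show ?case
      using main[OF elim(2)] by (elim order_trans) (simp add: ennreal_leI)
  qed
qed

end

text \<open>Here \<open>A\<close>, \<open>W\<close> and \<open>V\<close> are the rescaled cost of the large summands, their sum, and the fluctuation of the
  small ones. If \<open>A\<close> alone reaches \<open>J\<close>, the slope \<open>l = 0\<close> suffices; otherwise the number and the sum of the large
  summands are bounded and \<open>l\<close> has to approximate the optimal slope \<open>(s - W) / \<sigma>\<^sup>2\<close>.\<close>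

lemma prod_tilt_ge:
  fixes x :: "nat \<Rightarrow> nat" and \<alpha> \<mu> \<sigma> s t :: real
  assumes \<alpha>: "0 < \<alpha>" "\<alpha> < 1" and \<sigma>: "\<sigma> \<noteq> 0" and \<eta>: "0 < \<eta>" "\<eta> < 1" and \<delta>: "0 < \<delta>" and J: "0 < J" and n: "1 \<le> n"
    and sum: "real (\<Sum>i\<in>{1..n}. x i) = \<mu> * real n + t * real n powr gam \<alpha>"
    and f: "J \<le> f_fun \<alpha> \<sigma> s (real (Max (x ` {1..n})) / real n powr gam \<alpha>)"
    and f0: "\<And>y. 0 \<le> y \<Longrightarrow> y \<le> \<delta> \<Longrightarrow> f_fun \<alpha> \<sigma> s y \<le> f_fun \<alpha> \<sigma> s 0 + \<kappa>"
    and G: "\<And>u. \<bar>u\<bar> \<le> \<bar>s\<bar> + J powr (1 / \<alpha>) \<Longrightarrow> \<exists>l\<in>G. (u - l * \<sigma>\<^sup>2)\<^sup>2 / (2 * \<sigma>\<^sup>2) \<le> \<kappa>"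
    and G\<Lambda>: "\<And>l. l \<in> G \<Longrightarrow> \<bar>l\<bar> \<le> \<Lambda>" and G0: "0 \<in> G"
    and small: "\<Lambda> * (\<bar>t - s\<bar> + \<bar>\<mu>\<bar> * (J * \<delta> powr (-\<alpha>)) * real n powr (- gam \<alpha>)) \<le> \<kappa>"
  shows "\<exists>l\<in>G. exp (real n powr (gam \<alpha> * \<alpha>) * (l\<^sup>2 * \<sigma>\<^sup>2 / 2 + ((1 - \<eta>) * (J - \<kappa>) - 2 * \<kappa>)))
      \<le> (\<Prod>i\<in>{1..n}. tilt \<alpha> \<mu> \<eta> \<delta> l n (x i))"
proof -
  let ?\<gamma> = "gam \<alpha>"
  define N where "N = real n powr (?\<gamma> * \<alpha>)"
  define r where "r = real n powr ?\<gamma>"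
  define B where "B = {i \<in> {1..n}. \<delta> * r < real (x i)}"
  define g where "g i = real (x i) / r" for i
  define A where "A = (\<Sum>i\<in>B. g i powr \<alpha>)"
  define W where "W = (\<Sum>i\<in>B. g i)"
  \<comment> \<open>The last term arises because only the \<open>n - card B\<close> small summands
    are centred by \<mu>. It is negligible whenever \<open>card B\<close> stays bounded.\<close>
  define V where "V = t - W + \<mu> * real (card B) / r"
  note \<gamma> = gam_bounds[OF \<alpha>]
  have r: "0 < r" and N: "0 < N"
    using n by (auto simp: r_def N_def)
  have B: "finite B" "B \<subseteq> {1..n}"
    by (auto simp: B_def)
  have g0: "0 \<le> g i" for i
    using r by (simp add: g_def)
  have A0: "0 \<le> A" and W0: "0 \<le> W"
    using g0 by (auto simp: A_def W_def intro: sum_nonneg)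
  have \<kappa>: "0 \<le> \<kappa>"
    using f0[of 0] \<delta> by simp
  have xr: "real (x i) = r * g i" for i
    using r by (simp add: g_def)
  have xN: "real (x i) powr \<alpha> = N * g i powr \<alpha>" for i
    using r g0 by (simp add: xr powr_mult N_def r_def powr_powr)
  have smallsum: "(\<Sum>i\<in>{1..n} - B. real (x i) - \<mu>) = r * V"
  proof -
    have "(\<Sum>i\<in>{1..n}. real (x i)) = (\<Sum>i\<in>{1..n} - B. real (x i)) + (\<Sum>i\<in>B. real (x i))"
      using B by (intro sum.subset_diff) auto
    also have "(\<Sum>i\<in>B. real (x i)) = r * W"
      by (simp add: W_def xr sum_distrib_left)
    finally have "real (\<Sum>i\<in>{1..n}. x i) = (\<Sum>i\<in>{1..n} - B. real (x i)) + r * W"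
      by simp
    moreover have "real (card ({1..n} - B)) = real n - real (card B)"
      using B card_mono[OF _ B(2)] by (simp add: card_Diff_subset)
    then have "\<mu> * real (card ({1..n} - B)) = \<mu> * real n - \<mu> * real (card B)"
      by (simp only: right_diff_distrib)
    moreover have "(\<Sum>i\<in>{1..n} - B. real (x i) - \<mu>) = (\<Sum>i\<in>{1..n} - B. real (x i)) - \<mu> * real (card ({1..n} - B))"
      by (simp add: sum_subtractf)
    moreover have "r * V = r * t - r * W + \<mu> * real (card B)"
      using r by (simp add: V_def algebra_simps)
    ultimately show ?thesis
      using sum unfolding r_def[symmetric] mult.commute[of t] by linarith
  qed
  have Nr: "real n powr (?\<gamma> - 1) * r = N"
    unfolding r_def N_def \<gamma>(3) powr_add[symmetric] by simp
  have prod: "(\<Prod>i\<in>{1..n}. tilt \<alpha> \<mu> \<eta> \<delta> l n (x i)) = exp (N * ((1 - \<eta>) * A + l * V))" for l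
  proof -
    have "(\<Prod>i\<in>{1..n}. tilt \<alpha> \<mu> \<eta> \<delta> l n (x i))
        = (\<Prod>i\<in>{1..n} - B. tilt \<alpha> \<mu> \<eta> \<delta> l n (x i)) * (\<Prod>i\<in>B. tilt \<alpha> \<mu> \<eta> \<delta> l n (x i))"
      using B by (intro prod.subset_diff) auto
    also have "(\<Prod>i\<in>B. tilt \<alpha> \<mu> \<eta> \<delta> l n (x i)) = (\<Prod>i\<in>B. exp ((1 - \<eta>) * (N * g i powr \<alpha>)))"
      by (intro prod.cong) (auto simp: tilt_def B_def r_def[symmetric] xN)
    also have "\<dots> = exp (N * ((1 - \<eta>) * A))"
      unfolding exp_sum[OF B(1), symmetric] A_def by (simp add: sum_distrib_left mult.left_commute)
    also have "(\<Prod>i\<in>{1..n} - B. tilt \<alpha> \<mu> \<eta> \<delta> l n (x i))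
        = (\<Prod>i\<in>{1..n} - B. exp (l * real n powr (?\<gamma> - 1) * (real (x i) - \<mu>)))"
      by (intro prod.cong) (auto simp: tilt_def B_def r_def[symmetric])
    also have "\<dots> = exp (l * real n powr (?\<gamma> - 1) * (r * V))"
      unfolding smallsum[symmetric] by (simp add: sum_distrib_left flip: exp_sum)
    also have "l * real n powr (?\<gamma> - 1) * (r * V) = N * (l * V)"
      unfolding Nr[symmetric] by (simp add: mult_ac)
    finally show ?thesis
      by (simp add: distrib_left mult_exp_exp add.commute)
  qed
  show ?thesis
  proof (cases "J \<le> A")
    case True
    have "(1 - \<eta>) * (J - \<kappa>) - 2 * \<kappa> \<le> (1 - \<eta>) * A"
    proof -
      have "(1 - \<eta>) * (J - \<kappa>) \<le> (1 - \<eta>) * A"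
        using True \<kappa> \<eta> by (intro mult_left_mono) auto
      then show ?thesis
        using \<kappa> by linarith
    qed
    then show ?thesis
      using G0 N unfolding prod N_def[symmetric] by (intro bexI[of _ 0]) simp_all
  next
    case False
    \<comment> \<open>Each large summand contributes at least \<open>\<delta> powr \<alpha>\<close>
      to the cost, so there are few of them.\<close>
    have "real (card B) * \<delta> powr \<alpha> = (\<Sum>i\<in>B. \<delta> powr \<alpha>)"
      by simp
    also have "\<dots> \<le> A"
      unfolding A_def using \<delta> \<alpha> r by (intro sum_mono powr_mono2) (auto simp: B_def g_def field_simps)
    finally have "real (card B) * \<delta> powr \<alpha> \<le> J"
      using False by simp
    then have cB: "real (card B) \<le> J * \<delta> powr (- \<alpha>)"
      using \<delta> by (simp add: powr_minus_divide field_simps)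
    have "W powr \<alpha> \<le> J"
      using sum_powr_le[OF B(1), of g \<alpha>] g0 \<alpha> False by (simp add: W_def A_def)
    then have "(W powr \<alpha>) powr (1 / \<alpha>) \<le> J powr (1 / \<alpha>)"
      using \<alpha> by (intro powr_mono2) auto
    then have WJ: "W \<le> J powr (1 / \<alpha>)"
      using W0 \<alpha> by (simp add: powr_powr)
    define u where "u = s - W"
    have "\<bar>u\<bar> \<le> \<bar>s\<bar> + J powr (1 / \<alpha>)"
      using WJ W0 by (simp add: u_def)
    then obtain l where l: "l \<in> G" "(u - l * \<sigma>\<^sup>2)\<^sup>2 / (2 * \<sigma>\<^sup>2) \<le> \<kappa>"
      using G by blast
    \<comment> \<open>Completing the square: slope \<open>l\<close> recovers the full Gaussian cost
      up to its distance from the optimal slope \<open>u / \<sigma>\<^sup>2\<close>.\<close>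
    have quad: "l * u - l\<^sup>2 * \<sigma>\<^sup>2 / 2 = u\<^sup>2 / (2 * \<sigma>\<^sup>2) - (u - l * \<sigma>\<^sup>2)\<^sup>2 / (2 * \<sigma>\<^sup>2)"
      using \<sigma> by (simp add: power2_eq_square field_simps)
    have Vu: "l * V \<ge> l * u - \<kappa>"
    proof -
      have "\<bar>V - u\<bar> \<le> \<bar>t - s\<bar> + \<bar>\<mu>\<bar> * real (card B) / r"
      proof -
        have "V - u = (t - s) + \<mu> * real (card B) / r"
          by (simp add: V_def u_def)
        also have "\<bar>\<dots>\<bar> \<le> \<bar>t - s\<bar> + \<bar>\<mu> * real (card B) / r\<bar>"
          by (rule abs_triangle_ineq)
        finally show ?thesis
          using r by (simp add: abs_mult)
      qed
      also have "\<bar>\<mu>\<bar> * real (card B) / r \<le> \<bar>\<mu>\<bar> * (J * \<delta> powr (-\<alpha>)) * real n powr (- ?\<gamma>)"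
      proof -
        have "\<bar>\<mu>\<bar> * real (card B) / r \<le> \<bar>\<mu>\<bar> * (J * \<delta> powr (-\<alpha>)) / r"
          using cB r by (intro divide_right_mono mult_left_mono) auto
        also have "\<dots> = \<bar>\<mu>\<bar> * (J * \<delta> powr (-\<alpha>)) * real n powr (- ?\<gamma>)"
          unfolding r_def powr_minus[of "real n"] by (rule divide_inverse)
        finally show ?thesis .
      qed
      finally have "\<bar>V - u\<bar> \<le> \<bar>t - s\<bar> + \<bar>\<mu>\<bar> * (J * \<delta> powr (-\<alpha>)) * real n powr (- ?\<gamma>)"
        by simp
      then have "\<bar>l\<bar> * \<bar>V - u\<bar> \<le> \<Lambda> * (\<bar>t - s\<bar> + \<bar>\<mu>\<bar> * (J * \<delta> powr (-\<alpha>)) * real n powr (- ?\<gamma>))"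
        using G\<Lambda>[OF l(1)] by (intro mult_mono) auto
      then have "\<bar>l * (V - u)\<bar> \<le> \<kappa>"
        using small by (simp add: abs_mult)
      then show ?thesis
        by (simp add: right_diff_distrib abs_le_iff)
    qed
    \<comment> \<open>Either the maximum is itself large and heads the competitor formed by
      \<open>B\<close>, or all summands are small; then \<open>f\<close> at the maximum is compared
      with \<open>f\<close> at 0, where the zero sequence costs
      \<open>s\<^sup>2 / (2 * \<sigma>\<^sup>2)\<close>.\<close>
    have JA: "J - \<kappa> \<le> A + u\<^sup>2 / (2 * \<sigma>\<^sup>2)"
    proof (cases "B = {}")
      case False
      define m where "m = Max (x ` {1..n})"
      have "m \<in> x ` {1..n}"
        unfolding m_def using n by (intro Max_in) auto
      then obtain b where b: "b \<in> {1..n}" "x b = m"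
        by auto
      have le: "x i \<le> x b" if "i \<in> {1..n}" for i
        using that b by (simp add: m_def)
      have "b \<in> B"
        using False b le by (force simp: B_def intro: less_le_trans)
      have "f_fun \<alpha> \<sigma> s (g b) \<le> (\<Sum>i\<in>B. g i powr \<alpha>) + (s - (\<Sum>i\<in>B. g i))\<^sup>2 / (2 * \<sigma>\<^sup>2)"
        using B \<open>b \<in> B\<close> g0 le r
        by (intro f_fun_le_finite) (auto simp: g_def intro!: divide_right_mono)
      moreover have "J \<le> f_fun \<alpha> \<sigma> s (g b)"
        using f b by (simp add: g_def r_def m_def)
      ultimately show ?thesis
        using \<kappa> by (simp add: A_def u_def W_def)
    next
      case True
      then have "real (x i) \<le> \<delta> * r" if "i \<in> {1..n}" for i
        using that by (force simp: B_def)
      moreover have "Max (x ` {1..n}) \<in> x ` {1..n}"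
        using n by (intro Max_in) auto
      ultimately have "real (Max (x ` {1..n})) \<le> \<delta> * r"
        by auto
      then have "f_fun \<alpha> \<sigma> s (real (Max (x ` {1..n})) / r) \<le> f_fun \<alpha> \<sigma> s 0 + \<kappa>"
        using r by (intro f0) (simp_all add: field_simps)
      moreover have "f_fun \<alpha> \<sigma> s 0 \<le> s\<^sup>2 / (2 * \<sigma>\<^sup>2)"
        using f_fun_le_finite[of "{()}" "()" "\<lambda>_. 0" \<alpha> \<sigma> s] by simp
      ultimately show ?thesis
        using f True by (simp add: r_def A_def u_def W_def)
    qed
    have "(1 - \<eta>) * (J - \<kappa>) \<le> (1 - \<eta>) * A + (1 - \<eta>) * (u\<^sup>2 / (2 * \<sigma>\<^sup>2))"
      using mult_left_mono[OF JA, of "1 - \<eta>"] \<eta> by (simp add: distrib_left)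
    \<comment> \<open>Only the large summands were weighted with the loss \<eta>; the Gaussian part
      is available in full.\<close>
    also have "(1 - \<eta>) * (u\<^sup>2 / (2 * \<sigma>\<^sup>2)) \<le> u\<^sup>2 / (2 * \<sigma>\<^sup>2)"
      using \<eta> by (intro mult_left_le_one_le) auto
    finally have "(1 - \<eta>) * (J - \<kappa>) \<le> (1 - \<eta>) * A + u\<^sup>2 / (2 * \<sigma>\<^sup>2)"
      by simp
    then have "l\<^sup>2 * \<sigma>\<^sup>2 / 2 + ((1 - \<eta>) * (J - \<kappa>) - 2 * \<kappa>) \<le> (1 - \<eta>) * A + l * V"
      using Vu quad l(2) by linarith
    then show ?thesis
      using l(1) N unfolding prod N_def[symmetric] by (intro bexI[of _ l]) simp_all
  qed
qed

section \<open>Assembling the upper bound: choice of constants and Markov's inequality over the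
  grid\<close>

context stretched_iid
begin

definition max_event :: "real set \<Rightarrow> nat \<Rightarrow> real \<Rightarrow> 'a set" where
  "max_event A n v = {\<omega> \<in> space M. real (partial_max X n \<omega>) / real n powr gam \<alpha> \<in> A
     \<and> real (partial_sum X n \<omega>) = v}"

lemma max_event_upper:
  assumes t: "t \<longlonglongrightarrow> s" and \<kappa>: "0 < \<kappa>"
    and J: "\<And>y. y \<in> A \<Longrightarrow> J \<le> f_fun \<alpha> \<sigma> s y"
  shows "\<forall>\<^sub>F n in sequentially. prob (max_event A n (\<mu> * real n + t n * real n powr gam \<alpha>))
     \<le> exp (- (real n powr (gam \<alpha> * \<alpha>) * (J - \<kappa>)))"
proof (cases "0 < J")
  case False
  then have "J - \<kappa> \<le> 0"
    using \<kappa> by simp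
  then have "1 \<le> exp (- (real n powr (gam \<alpha> * \<alpha>) * (J - \<kappa>)))" for n
    by (simp add: mult_nonneg_nonpos)
  then show ?thesis
    by (intro always_eventually allI order_trans[OF prob_le_1])
next
  case True
  note \<gamma> = gam_bounds[OF \<alpha>] and \<sigma> = sigma_nonzero
  \<comment> \<open>Six losses of size \<open>k\<close>: three in \<open>prod_tilt_ge\<close>, one
    from \<open>\<eta> * J\<close>, one in the expectation and one for the cardinality of the
    grid.\<close>
  define k where "k = \<kappa> / 6"
  define \<eta> where "\<eta> = min (1/2) (k / J)"
  \<comment> \<open>Bounds the optimal slopes \<open>(s - W) / \<sigma>\<^sup>2\<close> over all
    sums \<open>W\<close> of large summands with cost below \<open>J\<close>.\<close>
  define \<Lambda> where "\<Lambda> = (\<bar>s\<bar> + J powr (1 / \<alpha>)) / \<sigma>\<^sup>2"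
  have k: "0 < k"
    using \<kappa> by (simp add: k_def)
  have \<eta>: "0 < \<eta>" "\<eta> < 1" "\<eta> * J \<le> k"
    using True k by (auto simp: \<eta>_def min_def field_simps)
  have \<Lambda>: "0 \<le> \<Lambda>"
    by (simp add: \<Lambda>_def)
  obtain d0 where d0: "0 < d0" "\<And>y y'. 0 \<le> y \<Longrightarrow> 0 \<le> y' \<Longrightarrow> \<bar>y - y'\<bar> < d0 \<Longrightarrow> f_fun \<alpha> \<sigma> s y' < f_fun \<alpha> \<sigma> s 0 + 1
      \<Longrightarrow> f_fun \<alpha> \<sigma> s y \<le> f_fun \<alpha> \<sigma> s y' + k"
    using f_fun_stable[OF \<alpha> \<sigma> k, of s "f_fun \<alpha> \<sigma> s 0 + 1"] by metis
  \<comment> \<open>A single \<delta> has to serve every slope of the grid, hence the bound in terms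
    of \<Lambda>.\<close>
  have "((\<lambda>d. \<Lambda> * d powr (1 - \<alpha>)) \<longlongrightarrow> \<Lambda> * 0) (at_right 0)"
    using \<alpha> by (intro tendsto_intros tendsto_powr_0_at_right) auto
  then have "\<forall>\<^sub>F d in at_right 0. \<Lambda> * d powr (1 - \<alpha>) < 1/2"
    by (rule order_tendstoD) simp
  then obtain d1 where d1: "0 < d1" "\<And>d. 0 < d \<Longrightarrow> d < d1 \<Longrightarrow> \<Lambda> * d powr (1 - \<alpha>) < 1/2"
    by (auto simp: eventually_at_right_field)
  define \<delta> where "\<delta> = min d0 d1 / 2"
  have \<delta>: "0 < \<delta>" "\<delta> < d0" "\<Lambda> * \<delta> powr (1 - \<alpha>) \<le> 1/2"
    using d0(1) d1(1) d1(2)[of \<delta>] by (auto simp: \<delta>_def min_def)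
  \<comment> \<open>The mesh for which the missed square,
    \<open>\<sigma>\<^sup>2 * e\<^sup>2 / 2\<close>, equals \<open>k\<close>.\<close>
  define e where "e = sqrt (2 * k / \<sigma>\<^sup>2)"
  have e: "0 < e"
    using k \<sigma> by (simp add: e_def)
  obtain G0 where G0: "G0 \<subseteq> {-\<Lambda>..\<Lambda>}" "finite G0" "{-\<Lambda>..\<Lambda>} \<subseteq> (\<Union>x\<in>G0. ball x e)"
    by (rule compactE_image[OF compact_Icc, of "{-\<Lambda>..\<Lambda>}" "\<lambda>x. ball x e" "-\<Lambda>" "\<Lambda>"]) (use e in auto)
  \<comment> \<open>Slope 0 is for samples whose large summands alone already cost
    \<open>J\<close>.\<close>
  define G where "G = insert 0 G0"
  have G: "finite G" "0 \<in> G" and G\<Lambda>: "\<And>l. l \<in> G \<Longrightarrow> \<bar>l\<bar> \<le> \<Lambda>"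
    using G0(1,2) \<Lambda> by (force simp: G_def abs_le_iff)+
  have grid: "\<exists>l\<in>G. (u - l * \<sigma>\<^sup>2)\<^sup>2 / (2 * \<sigma>\<^sup>2) \<le> k" if "\<bar>u\<bar> \<le> \<bar>s\<bar> + J powr (1 / \<alpha>)" for u
  proof -
    have "\<bar>u / \<sigma>\<^sup>2\<bar> \<le> \<Lambda>"
      using that \<sigma> by (simp add: \<Lambda>_def divide_right_mono)
    then have "u / \<sigma>\<^sup>2 \<in> {-\<Lambda>..\<Lambda>}"
      unfolding abs_le_iff atLeastAtMost_iff by linarith
    then obtain l where "l \<in> G0" "u / \<sigma>\<^sup>2 \<in> ball l e"
      using G0(3) by blast
    then have l: "l \<in> G" "\<bar>u / \<sigma>\<^sup>2 - l\<bar> < e"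
      by (simp_all add: G_def dist_real_def abs_minus_commute)
    have "(u / \<sigma>\<^sup>2 - l)\<^sup>2 \<le> e\<^sup>2"
      using l e by (simp flip: abs_le_square_iff)
    also have "e\<^sup>2 = 2 * k / \<sigma>\<^sup>2"
      using k by (simp add: e_def)
    finally have "\<sigma>\<^sup>2 / 2 * (u / \<sigma>\<^sup>2 - l)\<^sup>2 \<le> \<sigma>\<^sup>2 / 2 * (2 * k / \<sigma>\<^sup>2)"
      by (intro mult_left_mono) auto
    also have "\<sigma>\<^sup>2 / 2 * (2 * k / \<sigma>\<^sup>2) = k"
      using \<sigma> by simp
    also have "\<sigma>\<^sup>2 / 2 * (u / \<sigma>\<^sup>2 - l)\<^sup>2 = (u - l * \<sigma>\<^sup>2)\<^sup>2 / (2 * \<sigma>\<^sup>2)"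
      using \<sigma> by (simp add: power2_eq_square field_simps)
    finally show ?thesis
      using l(1) by blast
  qed
  have lim: "(\<lambda>n. \<Lambda> * (\<bar>t n - s\<bar> + \<bar>\<mu>\<bar> * (J * \<delta> powr (-\<alpha>)) * real n powr (- gam \<alpha>))) \<longlonglongrightarrow> \<Lambda> * (\<bar>s - s\<bar> + \<bar>\<mu>\<bar> * (J * \<delta> powr (-\<alpha>)) * 0)"
    using \<gamma> by (intro tendsto_intros t tendsto_neg_powr filterlim_real_sequentially) auto
  have ev1: "\<forall>\<^sub>F n in sequentially. \<Lambda> * (\<bar>t n - s\<bar> + \<bar>\<mu>\<bar> * (J * \<delta> powr (-\<alpha>)) * real n powr (- gam \<alpha>)) < k"
    using order_tendstoD(2)[OF lim, of k] k by simp
  have ev2: "\<forall>\<^sub>F n in sequentially. \<forall>l\<in>G. (\<integral>\<^sup>+\<omega>. (\<Prod>i\<in>{1..n}. tilt \<alpha> \<mu> \<eta> \<delta> l n (X i \<omega>)) \<partial>M)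
           \<le> ennreal (exp (real n powr (gam \<alpha> * \<alpha>) * (l\<^sup>2 * \<sigma>\<^sup>2 / 2 + k)))"
  proof (rule eventually_ball_finite[OF G(1)], rule ballI)
    fix l assume "l \<in> G"
    then have "\<bar>l\<bar> * \<delta> powr (1 - \<alpha>) \<le> \<Lambda> * \<delta> powr (1 - \<alpha>)"
      using G\<Lambda> by (intro mult_right_mono) auto
    then have "\<bar>l\<bar> * \<delta> powr (1 - \<alpha>) \<le> 1/2"
      using \<delta>(3) by linarith
    then show "\<forall>\<^sub>F n in sequentially. (\<integral>\<^sup>+\<omega>. (\<Prod>i\<in>{1..n}. tilt \<alpha> \<mu> \<eta> \<delta> l n (X i \<omega>)) \<partial>M)
           \<le> ennreal (exp (real n powr (gam \<alpha> * \<alpha>) * (l\<^sup>2 * \<sigma>\<^sup>2 / 2 + k)))"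
      using \<delta> \<eta> k by (intro expectation_prod_tilt_le)
  qed
  have "0 < gam \<alpha> * \<alpha>"
    using \<gamma> by simp
  then have "filterlim (\<lambda>n. real n powr (gam \<alpha> * \<alpha>)) at_top sequentially"
    by real_asymp
  then have "\<forall>\<^sub>F n in sequentially. ln (real (card G)) / k \<le> real n powr (gam \<alpha> * \<alpha>)"
    by (simp add: filterlim_at_top)
  then show ?thesis
    using ev1 ev2 eventually_ge_at_top[of 1]
  proof eventually_elim
    case (elim n)
    let ?N = "real n powr (gam \<alpha> * \<alpha>)"
    let ?E = "max_event A n (\<mu> * real n + t n * real n powr gam \<alpha>)"
    define c where "c = (1 - \<eta>) * (J - k) - 2 * k"
    have c: "J - 4 * k \<le> c"
    proof -
      have "(1 - \<eta>) * (J - k) = J - k - \<eta> * J + \<eta> * k"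
        by (simp add: algebra_simps)
      then show ?thesis
        using \<eta> k unfolding c_def by (smt (verit) mult_pos_pos)
    qed
    \<comment> \<open>The successful slope depends on \<omega>; summing over the grid removes this
      dependence. Integrating the inequality is Markov's inequality and the union bound in one
      step.\<close>
    have point: "indicator ?E \<omega> \<le> (\<Sum>l\<in>G. exp (- (?N * (l\<^sup>2 * \<sigma>\<^sup>2 / 2 + c))) * (\<Prod>i\<in>{1..n}. tilt \<alpha> \<mu> \<eta> \<delta> l n (X i \<omega>)))"
      (is "_ \<le> (\<Sum>l\<in>G. ?h l)") for \<omega>
    proof (cases "\<omega> \<in> ?E")
      case True
      then have E: "real (partial_max X n \<omega>) / real n powr gam \<alpha> \<in> A"
          "real (\<Sum>i\<in>{1..n}. X i \<omega>) = \<mu> * real n + t n * real n powr gam \<alpha>"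
        by (auto simp: max_event_def partial_sum_def)
      have "\<exists>l\<in>G. exp (?N * (l\<^sup>2 * \<sigma>\<^sup>2 / 2 + ((1 - \<eta>) * (J - k) - 2 * k)))
          \<le> (\<Prod>i\<in>{1..n}. tilt \<alpha> \<mu> \<eta> \<delta> l n (X i \<omega>))"
      proof (rule prod_tilt_ge[OF \<alpha> \<sigma> \<eta>(1,2) \<delta>(1) \<open>0 < J\<close> elim(4) E(2) _ _ grid G\<Lambda> G(2)])
        show "J \<le> f_fun \<alpha> \<sigma> s (real (Max ((\<lambda>i. X i \<omega>) ` {1..n})) / real n powr gam \<alpha>)"
          using E(1) J by (simp add: partial_max_def)
        show "f_fun \<alpha> \<sigma> s y \<le> f_fun \<alpha> \<sigma> s 0 + k" if "0 \<le> y" "y \<le> \<delta>" for y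
          using that \<delta> by (intro d0) auto
      qed (use elim(2) in auto)
      then obtain l where l: "l \<in> G" "exp (?N * (l\<^sup>2 * \<sigma>\<^sup>2 / 2 + c)) \<le> (\<Prod>i\<in>{1..n}. tilt \<alpha> \<mu> \<eta> \<delta> l n (X i \<omega>))"
        by (auto simp: c_def)
      have "1 = exp (- (?N * (l\<^sup>2 * \<sigma>\<^sup>2 / 2 + c))) * exp (?N * (l\<^sup>2 * \<sigma>\<^sup>2 / 2 + c))"
        by (simp flip: exp_add)
      also have "\<dots> \<le> ?h l"
        using l by (intro mult_left_mono) auto
      also have "\<dots> \<le> (\<Sum>l\<in>G. ?h l)"
        using l G by (intro member_le_sum) (auto simp: tilt_nonneg intro!: mult_nonneg_nonneg prod_nonneg)
      finally show ?thesis
        using True by simp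
    next
      case False
      then show ?thesis
        by (auto simp: tilt_nonneg intro!: sum_nonneg mult_nonneg_nonneg prod_nonneg)
    qed
    have meas: "(\<lambda>\<omega>. \<Prod>i\<in>{1..n}. tilt \<alpha> \<mu> \<eta> \<delta> l n (X i \<omega>)) \<in> borel_measurable M" for l
      by (intro borel_measurable_prod measurable_compose[OF X_measurable]) auto
    have "ennreal (prob ?E) \<le> (\<integral>\<^sup>+\<omega>. (\<Sum>l\<in>G. exp (- (?N * (l\<^sup>2 * \<sigma>\<^sup>2 / 2 + c))) * (\<Prod>i\<in>{1..n}. tilt \<alpha> \<mu> \<eta> \<delta> l n (X i \<omega>))) \<partial>M)"
    \<comment> \<open>A set outside \<open>events\<close> has measure 0, so the bound holds in
      either case.\<close>
    proof (cases "?E \<in> events")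
      case True
      then have "ennreal (prob ?E) = (\<integral>\<^sup>+\<omega>. ennreal (indicator ?E \<omega>) \<partial>M)"
        by (simp add: ennreal_indicator emeasure_eq_measure)
      also have "\<dots> \<le> (\<integral>\<^sup>+\<omega>. (\<Sum>l\<in>G. exp (- (?N * (l\<^sup>2 * \<sigma>\<^sup>2 / 2 + c))) * (\<Prod>i\<in>{1..n}. tilt \<alpha> \<mu> \<eta> \<delta> l n (X i \<omega>))) \<partial>M)"
        by (intro nn_integral_mono ennreal_leI point)
      finally show ?thesis .
    qed (simp add: measure_notin_sets)
    also have "\<dots> = (\<integral>\<^sup>+\<omega>. (\<Sum>l\<in>G. ennreal (exp (- (?N * (l\<^sup>2 * \<sigma>\<^sup>2 / 2 + c)))) * ennreal (\<Prod>i\<in>{1..n}. tilt \<alpha> \<mu> \<eta> \<delta> l n (X i \<omega>))) \<partial>M)"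
      by (intro nn_integral_cong)
        (subst sum_ennreal[symmetric]; auto simp: ennreal_mult prod_nonneg tilt_nonneg intro!: sum.cong mult_nonneg_nonneg prod_nonneg)
    also have "\<dots> = (\<Sum>l\<in>G. ennreal (exp (- (?N * (l\<^sup>2 * \<sigma>\<^sup>2 / 2 + c)))) * (\<integral>\<^sup>+\<omega>. (\<Prod>i\<in>{1..n}. tilt \<alpha> \<mu> \<eta> \<delta> l n (X i \<omega>)) \<partial>M))"
      using meas by (subst nn_integral_sum) (auto simp: nn_integral_cmult)
    also have "\<dots> \<le> (\<Sum>l\<in>G. ennreal (exp (- (?N * (l\<^sup>2 * \<sigma>\<^sup>2 / 2 + c)))) * ennreal (exp (?N * (l\<^sup>2 * \<sigma>\<^sup>2 / 2 + k))))"
      using elim(3) by (intro sum_mono mult_left_mono) auto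
    also have "\<dots> = (\<Sum>l\<in>G. ennreal (exp (- (?N * (c - k)))))"
      by (intro sum.cong) (auto simp: algebra_simps simp flip: ennreal_mult exp_add)
    also have "\<dots> = ennreal (real (card G) * exp (- (?N * (c - k))))"
      by (simp add: ennreal_mult ennreal_of_nat_eq_real_of_nat)
    finally have "prob ?E \<le> real (card G) * exp (- (?N * (c - k)))"
      by (simp add: ennreal_le_iff)
    also have "real (card G) \<le> exp (?N * k)"
    proof -
      have "ln (real (card G)) \<le> ?N * k"
        using elim(1) k by (simp add: field_simps)
      moreover have "0 < real (card G)"
        using G by (auto simp: card_gt_0_iff)
      ultimately show ?thesis
        by (metis exp_le_cancel_iff exp_ln)
    qed
    finally have "prob ?E \<le> exp (?N * k) * exp (- (?N * (c - k)))"
      by (simp add: mult_right_mono)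
    also have "\<dots> = exp (- (?N * (c - 2 * k)))"
      by (simp add: algebra_simps flip: exp_add)
    also have "\<dots> \<le> exp (- (?N * (J - \<kappa>)))"
      using c by (simp add: k_def mult_left_mono)
    finally show ?case .
  qed
qed

end

section \<open>The lower bound\<close>

text \<open>The probability that the first \<open>length xs\<close> variables take the values
  \<open>xs\<close> (see \<open>prob_list_eq\<close>). The lower bound works with sets of lists:
  concatenation multiplies weights, which replaces arguments about independent blocks of
  variables.\<close>

definition list_weight :: "real \<Rightarrow> nat list \<Rightarrow> real" where
  "list_weight \<alpha> xs = (\<Prod>k\<leftarrow>xs. stretched_prob \<alpha> k)"

lemma list_weight_append: "list_weight \<alpha> (xs @ ys) = list_weight \<alpha> xs * list_weight \<alpha> ys"
  by (simp add: list_weight_def)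

text \<open>The cap \<open>L\<close> prevents the Gaussian part from interfering with the prescribed
  maximum; it also makes the set finite.\<close>

definition bounded_lists :: "nat \<Rightarrow> real \<Rightarrow> real \<Rightarrow> real \<Rightarrow> nat list set" where
  "bounded_lists n L a c = {xs. length xs = n \<and> (\<forall>x\<in>set xs. real x \<le> L) \<and> a \<le> real (sum_list xs) \<and> real (sum_list xs) \<le> c}"

lemma finite_bounded_lists: "finite (bounded_lists n L a c)"
proof (rule finite_subset[OF _ finite_lists_length_eq])
  show "bounded_lists n L a c \<subseteq> {xs. set xs \<subseteq> {k. real k \<le> L} \<and> length xs = n}"
    by (auto simp: bounded_lists_def)
  show "finite {k. real k \<le> L}"
    by (rule finite_subset[of _ "{..nat \<lfloor>L\<rfloor>}"]) (auto simp: le_nat_floor)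
qed

text \<open>\<open>E\<close> consists of the concatenations of \<open>b\<close> blocks that each lie
  in their own window: only some of the long lists, but enough for a lower bound. Since the blocks
  have a fixed length, they can be read off the concatenation, so no weight is lost.\<close>

lemma bounded_lists_power:
  "\<exists>E \<subseteq> bounded_lists (b * n) L (real b * a) (real b * c).
     (\<Sum>xs\<in>E. list_weight \<alpha> xs) = (\<Sum>xs\<in>bounded_lists n L a c. list_weight \<alpha> xs) ^ b"
proof (induction b)
  case 0
  show ?case
    by (rule exI[of _ "{[]}"]) (simp add: bounded_lists_def list_weight_def)
next
  case (Suc b)
  then obtain E where E: "E \<subseteq> bounded_lists (b * n) L (real b * a) (real b * c)"
    "(\<Sum>xs\<in>E. list_weight \<alpha> xs) = (\<Sum>xs\<in>bounded_lists n L a c. list_weight \<alpha> xs) ^ b"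
    by blast
  let ?B = "bounded_lists n L a c" and ?f = "\<lambda>(xs, ys). xs @ (ys :: nat list)"
  have inj: "inj_on ?f (?B \<times> E)"
    using E(1) by (auto simp: inj_on_def bounded_lists_def)
  have "(\<Sum>zs\<in>?f ` (?B \<times> E). list_weight \<alpha> zs) = (\<Sum>(xs, ys)\<in>?B \<times> E. list_weight \<alpha> xs * list_weight \<alpha> ys)"
    by (subst sum.reindex[OF inj]) (simp add: case_prod_unfold list_weight_append)
  also have "\<dots> = (\<Sum>xs\<in>?B. list_weight \<alpha> xs) ^ Suc b"
    by (simp add: E(2)[symmetric] sum_product sum.cartesian_product)
  finally show ?case
    using E(1) by (intro exI[of _ "?f ` (?B \<times> E)"]) (auto simp: bounded_lists_def algebra_simps dest!: subsetD[OF E(1)])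
qed

section \<open>Gaussian windows, probabilities of value lists and the central limit theorem\<close>

lemma std_normal_interval_ge:
  assumes "a < c" "\<bar>a\<bar> \<le> K" "\<bar>c\<bar> \<le> K"
  shows "(c - a) * (exp (- K\<^sup>2 / 2) / sqrt (2 * pi)) \<le> measure std_normal_distribution {a<..c}"
proof -
  interpret real_distribution std_normal_distribution
    by (rule real_dist_normal_dist)
  let ?m = "exp (- K\<^sup>2 / 2) / sqrt (2 * pi)"
  have dens: "?m \<le> std_normal_density x" if "x \<in> {a<..c}" for x
  proof -
    have "\<bar>x\<bar> \<le> K"
      using that assms by auto
    then have "x\<^sup>2 \<le> K\<^sup>2"
      by (simp add: abs_le_square_iff[symmetric])
    then show ?thesis
      by (simp add: std_normal_density_def divide_right_mono)
  qed
  have "ennreal ((c - a) * ?m) = (\<integral>\<^sup>+x. ennreal ?m * indicator {a<..c} x \<partial>lborel)"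
    using assms by (subst nn_integral_cmult_indicator) (auto simp: mult.commute simp flip: ennreal_mult')
  also have "\<dots> \<le> (\<integral>\<^sup>+x. ennreal (std_normal_density x) * indicator {a<..c} x \<partial>lborel)"
    using dens by (intro nn_integral_mono) (auto simp: indicator_def intro: ennreal_leI)
  also have "\<dots> = emeasure std_normal_distribution {a<..c}"
    by (simp add: emeasure_density)
  finally show ?thesis
    by (simp add: emeasure_eq_measure)
qed

lemma isCont_cdf_std_normal: "isCont (cdf std_normal_distribution) x"
proof -
  interpret real_distribution std_normal_distribution
    by (rule real_dist_normal_dist)
  have "emeasure std_normal_distribution {x} = 0"
    by (simp add: emeasure_density nn_integral_indicator_singleton)
  then show ?thesis
    by (simp add: isCont_cdf measure_def)
qed

context stretched_iid
begin

lemma prob_list_eq: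
  assumes "length xs = n"
  shows "{\<omega> \<in> space M. map (\<lambda>i. X i \<omega>) [1..<Suc n] = xs} \<in> events"
    "prob {\<omega> \<in> space M. map (\<lambda>i. X i \<omega>) [1..<Suc n] = xs} = list_weight \<alpha> xs"
proof -
  have eq: "{\<omega> \<in> space M. map (\<lambda>i. X i \<omega>) [1..<Suc n] = xs}
      = {\<omega> \<in> space M. \<forall>i\<in>{1..n}. X i \<omega> = xs ! (i - 1)}" (is "?L = ?R")
  proof -
    have "map (\<lambda>i. X i \<omega>) [1..<Suc n] = xs \<longleftrightarrow> (\<forall>i\<in>{1..n}. X i \<omega> = xs ! (i - 1))" for \<omega>
    proof -
      have "map (\<lambda>i. X i \<omega>) [1..<Suc n] = xs \<longleftrightarrow> (\<forall>i<n. X (Suc i) \<omega> = xs ! i)"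
        using assms by (auto simp: list_eq_iff_nth_eq simp del: upt_Suc)
      also have "\<dots> \<longleftrightarrow> (\<forall>i\<in>{1..n}. X i \<omega> = xs ! (i - 1))"
        by (auto simp: Ball_def) (metis Suc_pred less_eq_Suc_le Suc_le_mono le_imp_less_Suc less_Suc_eq_le)
      finally show ?thesis .
    qed
    then show ?thesis
      by blast
  qed
  show "?L \<in> events"
    unfolding eq by measurable
  show "prob ?L = list_weight \<alpha> xs"
  \<comment> \<open>The product rule \<open>indep_varsD\<close> asks for a nonempty index
    set.\<close>
  proof (cases "n = 0")
    case True
    then show ?thesis
      using assms by (simp add: list_weight_def prob_space)
  next
    case False
    have "?R = (\<Inter>i\<in>{1..n}. X i -` {xs ! (i - 1)} \<inter> space M)"
      using False by auto
    then have "prob ?R = (\<Prod>i\<in>{1..n}. prob (X i -` {xs ! (i - 1)} \<inter> space M))"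
      using False by (simp only:) (rule indep_varsD[OF indep], auto)
    also have "\<dots> = (\<Prod>i\<in>{1..n}. stretched_prob \<alpha> (xs ! (i - 1)))"
      by (intro prod.cong refl) (auto simp: prob_X vimage_def Int_def conj_commute)
    also have "\<dots> = (\<Prod>i<n. stretched_prob \<alpha> (xs ! i))"
      by (simp add: prod.atLeast1_atMost_eq)
    also have "\<dots> = list_weight \<alpha> xs"
      using assms by (simp add: list_weight_def prod.list_conv_set_nth atLeast0LessThan)
    finally show ?thesis
      unfolding eq .
  qed
qed

lemma prob_lists:
  assumes "finite E" "\<And>xs. xs \<in> E \<Longrightarrow> length xs = n"
  shows "prob {\<omega> \<in> space M. map (\<lambda>i. X i \<omega>) [1..<Suc n] \<in> E} = (\<Sum>xs\<in>E. list_weight \<alpha> xs)"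
proof -
  have "{\<omega> \<in> space M. map (\<lambda>i. X i \<omega>) [1..<Suc n] \<in> E}
      = (\<Union>xs\<in>E. {\<omega> \<in> space M. map (\<lambda>i. X i \<omega>) [1..<Suc n] = xs})"
    by blast
  also have "prob \<dots> = (\<Sum>xs\<in>E. prob {\<omega> \<in> space M. map (\<lambda>i. X i \<omega>) [1..<Suc n] = xs})"
    using assms prob_list_eq(1) by (intro finite_measure_finite_Union) (auto simp: disjoint_family_on_def simp del: upt_Suc)
  also have "\<dots> = (\<Sum>xs\<in>E. list_weight \<alpha> xs)"
    using assms by (intro sum.cong prob_list_eq(2)) auto
  finally show ?thesis .
qed

text \<open>There are only countably many lists of naturals, so \<open>P\<close> may be arbitrary.
  In particular \<open>max_event A n v\<close> is an event for every set \<open>A\<close>.\<close>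

lemma events_list_pred: "{\<omega> \<in> space M. P (map (\<lambda>i. X i \<omega>) [1..<Suc n])} \<in> events"
proof -
  have "{\<omega> \<in> space M. P (map (\<lambda>i. X i \<omega>) [1..<Suc n])}
      = (\<Union>xs\<in>{xs. length xs = n \<and> P xs}. {\<omega> \<in> space M. map (\<lambda>i. X i \<omega>) [1..<Suc n] = xs})"
    by auto
  also have "\<dots> \<in> events"
  proof (rule sets.countable_UN')
    show "(\<lambda>xs. {\<omega> \<in> space M. map (\<lambda>i. X i \<omega>) [1..<Suc n] = xs}) ` {xs. length xs = n \<and> P xs} \<subseteq> events"
      using prob_list_eq(1) by blast
  qed (rule countableI_type)
  finally show ?thesis .
qed

lemma partial_sum_list: "partial_sum X n \<omega> = sum_list (map (\<lambda>i. X i \<omega>) [1..<Suc n])"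
  unfolding partial_sum_def interv_sum_list_conv_sum_set_nat by (intro sum.cong) auto

lemma partial_max_list: "partial_max X n \<omega> = Max (set (map (\<lambda>i. X i \<omega>) [1..<Suc n]))"
proof -
  have "set (map (\<lambda>i. X i \<omega>) [1..<Suc n]) = (\<lambda>i. X i \<omega>) ` {1..n}"
    unfolding set_map set_upt atLeastLessThanSuc_atLeastAtMost ..
  then show ?thesis
    by (simp only: partial_max_def)
qed

lemma max_event_events: "max_event A n v \<in> events"
  unfolding max_event_def partial_sum_list partial_max_list by (rule events_list_pred)

text \<open>The central limit theorem expects a sequence indexed by all naturals, whereas
  \<open>X\<close> starts at 1.\<close>

lemma indep_vars_shifted: "indep_vars (\<lambda>_. borel) (\<lambda>i \<omega>. real (X (Suc i) \<omega>)) UNIV"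
proof -
  have 1: "indep_vars (\<lambda>_. borel) (\<lambda>i \<omega>. real (X i \<omega>)) {1..}"
    by (rule indep_vars_compose2[OF indep]) auto
  show ?thesis
    unfolding indep_vars_def2
  proof (intro conjI ballI)
    show "random_variable borel (\<lambda>\<omega>. real (X (Suc i) \<omega>))" for i
      by (intro measurable_compose[OF X_measurable]) auto
    let ?F = "\<lambda>i. {(\<lambda>\<omega>. real (X i \<omega>)) -` A \<inter> space M |A. A \<in> sets (borel :: real measure)}"
    have F: "indep_sets ?F {1..}"
      using 1 by (simp add: indep_vars_def2)
    show "indep_sets (\<lambda>i. ?F (Suc i)) UNIV"
    proof (rule indep_setsI)
      fix i show "?F (Suc i) \<subseteq> events"
        using F unfolding indep_sets_def by auto
    next
      fix A J assume J: "J \<noteq> {}" "J \<subseteq> (UNIV :: nat set)" "finite J" "\<forall>j\<in>J. A j \<in> ?F (Suc j)"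
      have "prob (\<Inter>j\<in>Suc ` J. A (j - 1)) = (\<Prod>j\<in>Suc ` J. prob (A (j - 1)))"
        using J by (intro indep_setsD[OF F]) auto
      then show "prob (\<Inter>j\<in>J. A j) = (\<Prod>j\<in>J. prob (A j))"
        by (simp add: prod.reindex image_image)
    qed
  qed
qed

text \<open>The prefactor is kept explicit because it grows linearly with the width
  \<open>c - a\<close>: a wide enough window makes it at least 2, and then it survives being raised
  to the power of the number of blocks.\<close>

lemma clt_window:
  assumes ac: "a < c" "\<bar>a\<bar> \<le> K" "\<bar>c\<bar> \<le> K"
  shows "\<forall>\<^sub>F n in sequentially. (c - a) / (2 * \<bar>\<sigma>\<bar> * sqrt (2 * pi)) * exp (- K\<^sup>2 / (2 * \<sigma>\<^sup>2))
     \<le> prob {\<omega> \<in> space M. real n * \<mu> + a * sqrt n \<le> real (partial_sum X n \<omega>) \<and> real (partial_sum X n \<omega>) \<le> real n * \<mu> + c * sqrt n}"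
proof -
  \<comment> \<open>Only \<open>\<sigma>\<^sup>2\<close> is prescribed, so \<sigma> may be negative,
    while the central limit theorem asks for a positive standard deviation.\<close>
  define \<tau> where "\<tau> = \<bar>\<sigma>\<bar>"
  have \<tau>: "0 < \<tau>" "\<tau>\<^sup>2 = \<sigma>\<^sup>2"
    using sigma_nonzero by (auto simp: \<tau>_def)
  define Z where "Z n \<omega> = (\<Sum>i<n. real (X (Suc i) \<omega>) - \<mu>) / sqrt (real n * \<tau>\<^sup>2)" for n \<omega>
  have weak: "weak_conv_m (\<lambda>n. distr M borel (Z n)) std_normal_distribution"
    unfolding Z_def
  proof (rule central_limit_theorem[OF indep_vars_shifted])
    show "distr M borel (\<lambda>\<omega>. real (X (Suc n) \<omega>)) = distr (density (count_space UNIV) (\<lambda>k. ennreal (stretched_prob \<alpha> k))) borel real" for n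
      by (subst distr_X[of "Suc n", symmetric]) (auto simp: distr_distr comp_def)
  qed (use \<tau> mean_X var_X integrable_X_square in auto)
  have Z_meas: "Z n \<in> borel_measurable M" for n
    unfolding Z_def by (intro borel_measurable_divide borel_measurable_sum borel_measurable_diff measurable_compose[OF X_measurable]) auto
  let ?C = "\<lambda>n. cdf (distr M borel (Z n))" and ?N = "cdf std_normal_distribution"
  have conv: "(\<lambda>n. ?C n x) \<longlonglongrightarrow> ?N x" for x
    using weak isCont_cdf_std_normal by (auto simp: weak_conv_m_def weak_conv_def)
  have ac': "a / \<tau> < c / \<tau>"
    using ac \<tau> by (simp add: divide_strict_right_mono)
  interpret N: real_distribution std_normal_distribution
    by (rule real_dist_normal_dist)
  define q where "q = (c / \<tau> - a / \<tau>) * (exp (- (K / \<tau>)\<^sup>2 / 2) / sqrt (2 * pi))"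
  have q: "0 < q" "q \<le> ?N (c / \<tau>) - ?N (a / \<tau>)"
    using ac' std_normal_interval_ge[OF ac', of "K / \<tau>"] ac \<tau>
    by (auto simp: q_def N.cdf_diff_eq divide_right_mono intro!: mult_pos_pos)
  have "(\<lambda>n. ?C n (c / \<tau>) - ?C n (a / \<tau>)) \<longlonglongrightarrow> ?N (c / \<tau>) - ?N (a / \<tau>)"
    by (intro tendsto_diff conv)
  \<comment> \<open>Convergence gives any constant strictly below the limiting mass; half of its
    lower bound is convenient.\<close>
  then have "\<forall>\<^sub>F n in sequentially. q / 2 < ?C n (c / \<tau>) - ?C n (a / \<tau>)"
    using q by (intro order_tendstoD) auto
  then show ?thesis
    using eventually_ge_at_top[of 1]
  proof eventually_elim
    case (elim n)
    interpret D: prob_space "distr M borel (Z n)"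
      using Z_meas by (rule prob_space_distr)
    interpret D: real_distribution "distr M borel (Z n)"
      by unfold_locales auto
    have sn: "0 < sqrt (real n)"
      using elim by simp
    have "?C n (c / \<tau>) - ?C n (a / \<tau>) = prob (Z n -` {a / \<tau><..c / \<tau>} \<inter> space M)"
      using Z_meas ac' by (simp add: D.cdf_diff_eq measure_distr)
    also have "\<dots> \<le> prob {\<omega> \<in> space M. real n * \<mu> + a * sqrt n \<le> real (partial_sum X n \<omega>) \<and> real (partial_sum X n \<omega>) \<le> real n * \<mu> + c * sqrt n}"
    proof (rule finite_measure_mono)
      show "{\<omega> \<in> space M. real n * \<mu> + a * sqrt n \<le> real (partial_sum X n \<omega>) \<and> real (partial_sum X n \<omega>) \<le> real n * \<mu> + c * sqrt n} \<in> events"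
        unfolding partial_sum_list by (rule events_list_pred)
      have "Z n \<omega> = (real (partial_sum X n \<omega>) - real n * \<mu>) / (\<tau> * sqrt n)" for \<omega>
        using \<tau>(1) by (simp add: Z_def partial_sum_def sum.atLeast1_atMost_eq sum_subtractf real_sqrt_mult mult.commute)
      then have S: "real (partial_sum X n \<omega>) = real n * \<mu> + \<tau> * Z n \<omega> * sqrt n" for \<omega>
        using \<tau>(1) sn by simp
      show "Z n -` {a / \<tau><..c / \<tau>} \<inter> space M
          \<subseteq> {\<omega> \<in> space M. real n * \<mu> + a * sqrt n \<le> real (partial_sum X n \<omega>) \<and> real (partial_sum X n \<omega>) \<le> real n * \<mu> + c * sqrt n}"
      proof
        fix \<omega> assume \<omega>: "\<omega> \<in> Z n -` {a / \<tau><..c / \<tau>} \<inter> space M"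
        then have "a \<le> \<tau> * Z n \<omega>" "\<tau> * Z n \<omega> \<le> c"
          using \<tau>(1) by (auto simp: field_simps)
        then have "a * sqrt n \<le> \<tau> * Z n \<omega> * sqrt n" "\<tau> * Z n \<omega> * sqrt n \<le> c * sqrt n"
          using sn by (auto intro: mult_right_mono)
        then show "\<omega> \<in> {\<omega> \<in> space M. real n * \<mu> + a * sqrt n \<le> real (partial_sum X n \<omega>) \<and> real (partial_sum X n \<omega>) \<le> real n * \<mu> + c * sqrt n}"
          using \<omega> by (simp add: S)
      qed
    qed
    finally have "q / 2 \<le> prob {\<omega> \<in> space M. real n * \<mu> + a * sqrt n \<le> real (partial_sum X n \<omega>) \<and> real (partial_sum X n \<omega>) \<le> real n * \<mu> + c * sqrt n}"
      using elim by linarith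
    moreover have "q / 2 = (c - a) / (2 * \<bar>\<sigma>\<bar> * sqrt (2 * pi)) * exp (- K\<^sup>2 / (2 * \<sigma>\<^sup>2))"
      using \<tau> by (simp add: q_def \<tau>_def[symmetric] power_divide diff_divide_distrib[symmetric] mult.commute)
    ultimately show ?case
      by simp
  qed
qed

text \<open>The loss is a union bound with Markov's inequality for the squares. Second moments
  suffice: with \<open>L\<close> of order \<open>n\<^sup>\<gamma>\<close> and at most
  \<open>n\<close> entries the loss is of order \<open>n powr (1 - 2 * \<gamma>)\<close>.\<close>

lemma bounded_lists_weight_ge:
  assumes L: "0 < L"
  shows "prob {\<omega> \<in> space M. a \<le> real (partial_sum X n \<omega>) \<and> real (partial_sum X n \<omega>) \<le> c}
     - real n * (expectation (\<lambda>\<omega>. (real (X 1 \<omega>))\<^sup>2) / L\<^sup>2) \<le> (\<Sum>xs\<in>bounded_lists n L a c. list_weight \<alpha> xs)"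
proof -
  let ?W = "{\<omega> \<in> space M. a \<le> real (partial_sum X n \<omega>) \<and> real (partial_sum X n \<omega>) \<le> c}"
  let ?B = "{\<omega> \<in> space M. map (\<lambda>i. X i \<omega>) [1..<Suc n] \<in> bounded_lists n L a c}"
  let ?T = "\<lambda>i. {\<omega> \<in> space M. L\<^sup>2 \<le> (real (X i \<omega>))\<^sup>2}"
  have T: "?T i \<in> events" if "1 \<le> i" for i
    using that by measurable
  have le: "prob (?T i) \<le> expectation (\<lambda>\<omega>. (real (X 1 \<omega>))\<^sup>2) / L\<^sup>2" if i: "1 \<le> i" for i
    using integral_Markov_inequality_measure[OF integrable_X_square[OF i], where A = "{}" and c = "L\<^sup>2"] L
      expectation_X_eq[OF i, of 1 "\<lambda>k. (real k)\<^sup>2"] by (simp cong: conj_cong)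
  have "?W \<subseteq> ?B \<union> (\<Union>i\<in>{1..n}. ?T i)"
  proof
    fix \<omega> assume \<omega>: "\<omega> \<in> ?W"
    show "\<omega> \<in> ?B \<union> (\<Union>i\<in>{1..n}. ?T i)"
    proof (cases "\<forall>i\<in>{1..n}. real (X i \<omega>) \<le> L")
      case True
      then have "\<forall>x\<in>set (map (\<lambda>i. X i \<omega>) [1..<Suc n]). real x \<le> L"
        by (auto simp del: upt_Suc)
      then have "\<omega> \<in> ?B"
        using \<omega> by (simp add: bounded_lists_def partial_sum_list del: upt_Suc)
      then show ?thesis ..
    next
      case False
      then obtain i where i: "i \<in> {1..n}" "L < real (X i \<omega>)"
        by force
      then have "L\<^sup>2 \<le> (real (X i \<omega>))\<^sup>2"
        using L by (intro power_mono) auto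
      then show ?thesis
        using i \<omega> by blast
    qed
  qed
  then have "prob ?W \<le> prob (?B \<union> (\<Union>i\<in>{1..n}. ?T i))"
    using T by (intro finite_measure_mono sets.Un events_list_pred sets.finite_UN) auto
  also have "\<dots> \<le> prob ?B + prob (\<Union>i\<in>{1..n}. ?T i)"
    using T by (intro measure_Un_le events_list_pred sets.finite_UN) auto
  also have "prob (\<Union>i\<in>{1..n}. ?T i) \<le> (\<Sum>i\<in>{1..n}. prob (?T i))"
    using T by (intro finite_measure_subadditive_finite) auto
  also have "\<dots> \<le> (\<Sum>i\<in>{1..n}. expectation (\<lambda>\<omega>. (real (X 1 \<omega>))\<^sup>2) / L\<^sup>2)"
    using le by (intro sum_mono) auto
  also have "prob ?B = (\<Sum>xs\<in>bounded_lists n L a c. list_weight \<alpha> xs)"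
    by (intro prob_lists finite_bounded_lists) (simp add: bounded_lists_def)
  finally show ?thesis
    by simp
qed

end

text \<open>With \<open>b\<close> blocks of length \<open>l\<close>, a deviation of order \<open>n\<^sup>\<gamma>\<close> of the whole sum amounts to deviations of the
  fixed size \<open>T\<close> in units of the standard deviation of a block, which is the scale of the central limit theorem;
  the block probability \<open>exp (- T\<^sup>2 / 2)\<close> is then raised to the power \<open>b \<approx> n powr (2 * \<gamma> - 1) / T\<^sup>2\<close>.\<close>

lemma block_asymptotics:
  fixes \<gamma> T :: real and m :: nat
  assumes \<gamma>: "1/2 < \<gamma>" "\<gamma> < 1" and T: "0 < T"
  defines "b \<equiv> \<lambda>n::nat. nat \<lfloor>real n powr (2 * \<gamma> - 1) / T\<^sup>2\<rfloor>"
  defines "l \<equiv> \<lambda>n. (n - m - 1) div b n"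
  shows "\<forall>\<^sub>F n in sequentially. 1 \<le> b n"
    and "filterlim l at_top sequentially"
    and "(\<lambda>n. real n powr \<gamma> / (real (b n) * sqrt (real (l n)))) \<longlonglongrightarrow> T"
proof -
  define N where "N n = real n powr (2 * \<gamma> - 1)" for n :: nat
  \<comment> \<open>Entries covered by blocks; \<open>m + 1\<close> places are reserved for planted
    values. The division leaves fewer than \<open>b n\<close> entries over, and \<open>b n\<close>
    is of smaller order than \<open>n\<close>, so \<open>p n / n\<close> tends to 1.\<close>
  define p where "p n = real (b n) * real (l n)" for n
  have N_top: "filterlim N at_top sequentially"
    unfolding N_def using \<gamma> by real_asymp
  have T2: "0 < T\<^sup>2"
    using T by simp
  have b_le: "real (b n) \<le> N n / T\<^sup>2" for n
    using T2 by (simp add: b_def N_def)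
  have b_ge: "N n / T\<^sup>2 - 1 \<le> real (b n)" for n
    unfolding b_def N_def by linarith
  have "\<forall>\<^sub>F n in sequentially. 2 * T\<^sup>2 \<le> N n"
    using N_top by (simp add: filterlim_at_top)
  then show b1: "\<forall>\<^sub>F n in sequentially. 1 \<le> b n"
  proof eventually_elim
    case (elim n)
    then have "2 \<le> N n / T\<^sup>2"
      using T2 by (simp add: field_simps)
    then have "1 \<le> real (b n)"
      using b_ge[of n] by linarith
    then show ?case
      by simp
  qed
  have bN: "(\<lambda>n. real (b n) / N n) \<longlonglongrightarrow> 1 / T\<^sup>2"
  proof (rule tendsto_sandwich)
    show "\<forall>\<^sub>F n in sequentially. 1 / T\<^sup>2 - inverse (N n) \<le> real (b n) / N n"
      using eventually_gt_at_top[of 0]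
    proof eventually_elim
      case (elim n)
      then have "0 < N n"
        by (simp add: N_def)
      then show ?case
        using divide_right_mono[OF b_ge[of n], of "N n"] by (simp add: diff_divide_distrib inverse_eq_divide)
    qed
    show "\<forall>\<^sub>F n in sequentially. real (b n) / N n \<le> 1 / T\<^sup>2"
      using eventually_gt_at_top[of 0]
    proof eventually_elim
      case (elim n)
      then have "0 < N n"
        by (simp add: N_def)
      then show ?case
        using divide_right_mono[OF b_le[of n], of "N n"] by simp
    qed
    have "(\<lambda>n. 1 / T\<^sup>2 - inverse (N n)) \<longlonglongrightarrow> 1 / T\<^sup>2 - 0"
      by (intro tendsto_intros tendsto_inverse_0_at_top N_top)
    then show "(\<lambda>n. 1 / T\<^sup>2 - inverse (N n)) \<longlonglongrightarrow> 1 / T\<^sup>2"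
      by simp
  qed simp
  have Nb: "(\<lambda>n. N n / real (b n)) \<longlonglongrightarrow> T\<^sup>2"
    using tendsto_inverse[OF bN] T2 by simp
  have pn: "(\<lambda>n. p n / real n) \<longlonglongrightarrow> 1"
  proof (rule tendsto_sandwich)
    show "\<forall>\<^sub>F n in sequentially. 1 - (real m + 1) / real n - real n powr (2 * \<gamma> - 2) / T\<^sup>2 \<le> p n / real n"
      using b1 eventually_gt_at_top[of "m + 1"]
    proof eventually_elim
      case (elim n)
      have "n - m - 1 = b n * l n + (n - m - 1) mod b n"
        unfolding l_def by (rule mult_div_mod_eq[symmetric])
      moreover have "(n - m - 1) mod b n < b n"
        using elim by simp
      ultimately have "n - m - 1 \<le> b n * l n + b n"
        by linarith
      then have "real (n - m - 1) \<le> p n + real (b n)"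
        unfolding p_def by (metis of_nat_add of_nat_le_iff of_nat_mult)
      then have "real n - (real m + 1) - N n / T\<^sup>2 \<le> p n"
        using elim b_le[of n] by (simp add: of_nat_diff)
      then have "(real n - (real m + 1) - N n / T\<^sup>2) / real n \<le> p n / real n"
        by (intro divide_right_mono) auto
      moreover have "N n / real n = real n powr (2 * \<gamma> - 2)"
        using elim powr_diff[of "real n" "2 * \<gamma> - 1" 1] by (simp add: N_def)
      ultimately show ?case
        using elim by (simp add: diff_divide_distrib) (simp add: field_simps)
    qed
    show "\<forall>\<^sub>F n in sequentially. p n / real n \<le> 1"
      using eventually_gt_at_top[of 0]
    proof eventually_elim
      case (elim n)
      have "b n * l n \<le> n"
        unfolding l_def using times_div_less_eq_dividend[of "b n" "n - m - 1"] by linarith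
      then have "p n \<le> real n"
        unfolding p_def by (metis of_nat_le_iff of_nat_mult)
      then show ?case
        using elim by simp
    qed
    show "(\<lambda>n. 1 - (real m + 1) / real n - real n powr (2 * \<gamma> - 2) / T\<^sup>2) \<longlonglongrightarrow> 1"
      using \<gamma> T by real_asymp
  qed simp
  \<comment> \<open>The quotient to be computed is the square root of
    \<open>(N / b) * (n / p)\<close>, because \<open>N n * real n\<close> is the square of
    \<open>n\<^sup>\<gamma>\<close>.\<close>
  have "(\<lambda>n. sqrt (N n / real (b n) * inverse (p n / real n))) \<longlonglongrightarrow> sqrt (T\<^sup>2 * inverse 1)"
    by (intro tendsto_intros Nb pn) auto
  then have lim: "(\<lambda>n. sqrt (N n / real (b n) * inverse (p n / real n))) \<longlonglongrightarrow> T"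
    using T by simp
  show "(\<lambda>n. real n powr \<gamma> / (real (b n) * sqrt (real (l n)))) \<longlonglongrightarrow> T"
  proof (rule Lim_transform_eventually[OF lim])
    show "\<forall>\<^sub>F n in sequentially. sqrt (N n / real (b n) * inverse (p n / real n))
        = real n powr \<gamma> / (real (b n) * sqrt (real (l n)))"
      using eventually_gt_at_top[of 0]
    proof eventually_elim
      case (elim n)
      have "N n * real n = (real n powr \<gamma>)\<^sup>2"
        using elim powr_add[of "real n" "2 * \<gamma> - 1" 1] by (simp add: N_def powr_power)
      then have "N n / real (b n) * inverse (p n / real n) = (real n powr \<gamma>)\<^sup>2 / ((real (b n))\<^sup>2 * real (l n))"
        by (simp add: p_def power2_eq_square field_simps)
      then show ?case
        by (simp add: real_sqrt_divide real_sqrt_mult)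
    qed
  qed
  have "filterlim (\<lambda>n. (p n / real n * (N n / real (b n))) * real n powr (2 - 2 * \<gamma>)) at_top sequentially"
  proof (rule filterlim_tendsto_pos_mult_at_top)
    show "(\<lambda>n. p n / real n * (N n / real (b n))) \<longlonglongrightarrow> 1 * T\<^sup>2"
      by (intro tendsto_mult pn Nb)
    show "filterlim (\<lambda>n. real n powr (2 - 2 * \<gamma>)) at_top sequentially"
      using \<gamma> by real_asymp
  qed (use T2 in simp)
  then have "filterlim (\<lambda>n. real (l n)) at_top sequentially"
  proof (rule filterlim_mono_eventually[OF _ order_refl order_refl])
    show "\<forall>\<^sub>F n in sequentially. p n / real n * (N n / real (b n)) * real n powr (2 - 2 * \<gamma>) = real (l n)"
      using b1 eventually_gt_at_top[of 0]
    proof eventually_elim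
      case (elim n)
      have "N n * real n powr (2 - 2 * \<gamma>) = real n"
        using elim powr_add[of "real n" "2 * \<gamma> - 1" "2 - 2 * \<gamma>"] by (simp add: N_def)
      moreover have "p n / real n * (N n / real (b n)) * real n powr (2 - 2 * \<gamma>)
          = real (l n) * (N n * real n powr (2 - 2 * \<gamma>)) / real n"
        using elim by (simp add: p_def)
      ultimately show ?case
        using elim by simp
    qed
  qed
  then show "filterlim l at_top sequentially"
    by (simp add: filterlim_sequentially_iff_filterlim_real)
qed

section \<open>Moderate deviations of the bulk by independent blocks\<close>

context stretched_iid
begin

lemma moderate_deviation_lists:
  assumes \<delta>: "0 < \<delta>" and \<epsilon>: "0 < \<epsilon>" and T: "0 < T" "8 * \<bar>\<sigma>\<bar> * sqrt (2 * pi) \<le> \<delta> * T"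
  shows "\<forall>\<^sub>F n in sequentially. \<exists>p E. p + m + 1 \<le> n \<and> real (n - m - 1 - p) \<le> real n powr (gam \<alpha> * \<alpha>) / T\<^sup>2
    \<and> E \<subseteq> bounded_lists p (\<epsilon> * real n powr gam \<alpha>) (real p * \<mu> + (u - 2 * \<delta>) * real n powr gam \<alpha>) (real p * \<mu> + (u - \<delta>) * real n powr gam \<alpha>)
    \<and> exp (- (real n powr (gam \<alpha> * \<alpha>) * ((\<bar>u\<bar> + 2 * \<delta>)\<^sup>2 / (2 * \<sigma>\<^sup>2)))) \<le> (\<Sum>xs\<in>E. list_weight \<alpha> xs)"
proof -
  note \<gamma> = gam_bounds[OF \<alpha>]
  define b where "b n = nat \<lfloor>real n powr (2 * gam \<alpha> - 1) / T\<^sup>2\<rfloor>" for n :: nat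
  define l where "l n = (n - m - 1) div b n" for n
  define K where "K = (\<bar>u\<bar> + 2 * \<delta>) * T"
  define B where "B = expectation (\<lambda>\<omega>. (real (X 1 \<omega>))\<^sup>2)"
  \<comment> \<open>Both ends \<open>a\<close> and \<open>c\<close> lie strictly inside the window
    scaled by \<open>T\<close>, because the block scale \<open>h n\<close> reaches \<open>T\<close>
    only in the limit.\<close>
  define a where "a = (u - 7/4 * \<delta>) * T"
  define c where "c = (u - 5/4 * \<delta>) * T"
  define h where "h n = real n powr gam \<alpha> / (real (b n) * sqrt (real (l n)))" for n
  define q where "q = exp (- K\<^sup>2 / (2 * \<sigma>\<^sup>2))"
  note block = block_asymptotics(1)[OF \<gamma>(1,2) T(1), folded b_def]
    block_asymptotics(2,3)[OF \<gamma>(1,2) T(1), of m, folded b_def, folded l_def]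
  have q0: "0 < q"
    by (simp add: q_def)
  have B0: "0 \<le> B"
    unfolding B_def by (intro integral_nonneg_AE) auto
  have ac: "a < c" "\<bar>a\<bar> \<le> K" "\<bar>c\<bar> \<le> K"
  proof -
    show "a < c"
      unfolding a_def c_def using \<delta> T by (intro mult_strict_right_mono) auto
    have "\<bar>u - 7/4 * \<delta>\<bar> \<le> \<bar>u\<bar> + 2 * \<delta>" "\<bar>u - 5/4 * \<delta>\<bar> \<le> \<bar>u\<bar> + 2 * \<delta>"
      using \<delta> by auto
    then show "\<bar>a\<bar> \<le> K" "\<bar>c\<bar> \<le> K"
      unfolding a_def c_def K_def using T by (auto simp: abs_mult intro: mult_right_mono)
  qed
  \<comment> \<open>Here the hypothesis relating \<delta> and \<open>T\<close> enters. Of the two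
    copies of \<open>q\<close>, one pays for capping the entries (\<open>ev3\<close>) and the other
    remains per block.\<close>
  have "2 * q \<le> (c - a) / (2 * \<bar>\<sigma>\<bar> * sqrt (2 * pi)) * q"
  proof (rule mult_right_mono)
    have "c - a = \<delta> * T / 2"
      by (simp add: a_def c_def algebra_simps)
    then show "2 \<le> (c - a) / (2 * \<bar>\<sigma>\<bar> * sqrt (2 * pi))"
      using T sigma_nonzero by (simp add: pos_le_divide_eq)
  qed (use q0 in simp)
  then have "\<forall>\<^sub>F n in sequentially. 2 * q \<le> prob {\<omega> \<in> space M. real n * \<mu> + a * sqrt n \<le> real (partial_sum X n \<omega>)
      \<and> real (partial_sum X n \<omega>) \<le> real n * \<mu> + c * sqrt n}"
    using clt_window[OF ac] unfolding q_def[symmetric] by (auto elim: eventually_mono)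
  then have ev1: "\<forall>\<^sub>F n in sequentially. 2 * q \<le> prob {\<omega> \<in> space M. real (l n) * \<mu> + a * sqrt (l n) \<le> real (partial_sum X (l n) \<omega>)
      \<and> real (partial_sum X (l n) \<omega>) \<le> real (l n) * \<mu> + c * sqrt (l n)}"
    by (rule eventually_compose_filterlim[OF _ block(2)])
  have "((\<lambda>n. (u - 2 * \<delta>) * h n) \<longlonglongrightarrow> (u - 2 * \<delta>) * T)" "((\<lambda>n. (u - \<delta>) * h n) \<longlonglongrightarrow> (u - \<delta>) * T)"
    unfolding h_def by (intro tendsto_intros block(3))+
  moreover have "(u - 2 * \<delta>) * T < a" "c < (u - \<delta>) * T"
    unfolding a_def c_def using \<delta> T by (auto intro!: mult_strict_right_mono)
  ultimately have ev2: "\<forall>\<^sub>F n in sequentially. (u - 2 * \<delta>) * h n < a" "\<forall>\<^sub>F n in sequentially. c < (u - \<delta>) * h n"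
    by (auto dest: order_tendstoD)
  have "(\<lambda>n. B / \<epsilon>\<^sup>2 * real n powr (1 - 2 * gam \<alpha>)) \<longlonglongrightarrow> B / \<epsilon>\<^sup>2 * 0"
    using \<gamma> by (intro tendsto_intros tendsto_neg_powr filterlim_real_sequentially) auto
  then have ev3: "\<forall>\<^sub>F n in sequentially. B / \<epsilon>\<^sup>2 * real n powr (1 - 2 * gam \<alpha>) < q"
    using q0 by (intro order_tendstoD) auto
  have ev4: "\<forall>\<^sub>F n in sequentially. 1 \<le> l n"
    using block(2) by (simp add: filterlim_at_top)
  show ?thesis
    using block(1) ev1 ev2 ev3 ev4 eventually_gt_at_top[of "m + 1"]
  proof eventually_elim
    case (elim n)
    let ?r = "real n powr gam \<alpha>" and ?N = "real n powr (gam \<alpha> * \<alpha>)"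
    define p where "p = b n * l n"
    have b0: "0 < real (b n)" and l0: "0 < real (l n)" and n0: "0 < real n"
      using elim by auto
    have hr: "h n * sqrt (l n) = ?r / real (b n)"
      using l0 b0 by (simp add: h_def)
    have p: "p \<le> n - m - 1"
      unfolding p_def l_def by simp
    have rem: "n - m - 1 - p = (n - m - 1) mod b n"
      unfolding p_def l_def by (simp add: minus_mult_div_eq_mod)
    also have "\<dots> \<le> b n"
      using elim by (simp add: less_imp_le)
    finally have "real (n - m - 1 - p) \<le> real (b n)"
      by simp
    also have bN: "real (b n) \<le> ?N / T\<^sup>2"
      unfolding b_def \<gamma>(3) by simp
    finally have rem': "real (n - m - 1 - p) \<le> ?N / T\<^sup>2" .
    define a' where "a' = real (l n) * \<mu> + (u - 2 * \<delta>) * ?r / real (b n)"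
    define c' where "c' = real (l n) * \<mu> + (u - \<delta>) * ?r / real (b n)"
    have a': "a' \<le> real (l n) * \<mu> + a * sqrt (l n)"
    proof -
      have "(u - 2 * \<delta>) * h n * sqrt (l n) \<le> a * sqrt (l n)"
        using elim by (intro mult_right_mono) auto
      then show ?thesis
        by (simp add: a'_def mult.assoc hr)
    qed
    have c': "real (l n) * \<mu> + c * sqrt (l n) \<le> c'"
    proof -
      have "c * sqrt (l n) \<le> (u - \<delta>) * h n * sqrt (l n)"
        using elim by (intro mult_right_mono) auto
      then show ?thesis
        by (simp add: c'_def mult.assoc hr)
    qed
    have "l n \<le> n"
      unfolding l_def by (rule order_trans[OF div_le_dividend]) simp
    have "real (l n) * (B / (\<epsilon> * ?r)\<^sup>2) \<le> real n * (B / (\<epsilon> * ?r)\<^sup>2)"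
      using B0 \<open>l n \<le> n\<close> by (intro mult_right_mono) auto
    also have "\<dots> = B / \<epsilon>\<^sup>2 * real n powr (1 - 2 * gam \<alpha>)"
      using n0 by (simp add: power_mult_distrib powr_diff powr_power mult.commute)
    finally have small: "real (l n) * (B / (\<epsilon> * ?r)\<^sup>2) \<le> q"
      using elim by linarith
    have "2 * q \<le> prob {\<omega> \<in> space M. a' \<le> real (partial_sum X (l n) \<omega>) \<and> real (partial_sum X (l n) \<omega>) \<le> c'}"
    proof (rule order_trans[OF elim(2)])
      show "prob {\<omega> \<in> space M. real (l n) * \<mu> + a * sqrt (l n) \<le> real (partial_sum X (l n) \<omega>)
          \<and> real (partial_sum X (l n) \<omega>) \<le> real (l n) * \<mu> + c * sqrt (l n)}
        \<le> prob {\<omega> \<in> space M. a' \<le> real (partial_sum X (l n) \<omega>) \<and> real (partial_sum X (l n) \<omega>) \<le> c'}"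
      proof (rule finite_measure_mono)
        show "{\<omega> \<in> space M. a' \<le> real (partial_sum X (l n) \<omega>) \<and> real (partial_sum X (l n) \<omega>) \<le> c'} \<in> events"
          unfolding partial_sum_list by (rule events_list_pred)
      qed (use a' c' in auto)
    qed
    moreover have "0 < \<epsilon> * ?r"
      using \<epsilon> n0 by simp
    ultimately have wq: "q \<le> (\<Sum>xs\<in>bounded_lists (l n) (\<epsilon> * ?r) a' c'. list_weight \<alpha> xs)"
      using bounded_lists_weight_ge[of "\<epsilon> * ?r" a' "l n" c'] small unfolding B_def[symmetric] by linarith
    obtain E where E: "E \<subseteq> bounded_lists (b n * l n) (\<epsilon> * ?r) (real (b n) * a') (real (b n) * c')"
      "(\<Sum>xs\<in>E. list_weight \<alpha> xs) = (\<Sum>xs\<in>bounded_lists (l n) (\<epsilon> * ?r) a' c'. list_weight \<alpha> xs) ^ b n"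
      using bounded_lists_power by blast
    \<comment> \<open>\<open>K\<^sup>2\<close> contains the factor \<open>T\<^sup>2\<close> while
      there are at most \<open>N / T\<^sup>2\<close> blocks, so \<open>T\<close> drops out of the
      exponent.\<close>
    have "exp (- (?N * ((\<bar>u\<bar> + 2 * \<delta>)\<^sup>2 / (2 * \<sigma>\<^sup>2)))) = exp (- (?N / T\<^sup>2 * (K\<^sup>2 / (2 * \<sigma>\<^sup>2))))"
      using T by (simp add: K_def power_mult_distrib)
    also have "\<dots> \<le> exp (- (real (b n) * (K\<^sup>2 / (2 * \<sigma>\<^sup>2))))"
      using mult_right_mono[OF bN, of "K\<^sup>2 / (2 * \<sigma>\<^sup>2)"] by simp
    also have "\<dots> = q ^ b n"
      by (simp add: q_def flip: exp_of_nat_mult)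
    also have "\<dots> \<le> (\<Sum>xs\<in>E. list_weight \<alpha> xs)"
      unfolding E(2) using wq q0 by (intro power_mono) auto
    finally have "exp (- (?N * ((\<bar>u\<bar> + 2 * \<delta>)\<^sup>2 / (2 * \<sigma>\<^sup>2)))) \<le> (\<Sum>xs\<in>E. list_weight \<alpha> xs)" .
    moreover have "real (b n) * a' = real p * \<mu> + (u - 2 * \<delta>) * ?r" "real (b n) * c' = real p * \<mu> + (u - \<delta>) * ?r"
      using b0 by (simp_all add: a'_def c'_def p_def distrib_left)
    ultimately show ?case
      using E(1) p elim rem' unfolding p_def[symmetric] by (intro exI[of _ p] exI[of _ E]) auto
  qed
qed

end

section \<open>Planting the large summands: the lower bound for the joint event\<close>

lemma list_weight_replicate_0: "list_weight \<alpha> (replicate r 0) = norm_const \<alpha> ^ r"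
  by (induction r) (simp_all add: list_weight_def stretched_prob_def)

context stretched_iid
begin

lemma norm_const_le_1: "norm_const \<alpha> \<le> 1"
  using prob_X[of 1 0] prob_le_1[of "{\<omega> \<in> space M. X 1 \<omega> = 0}"] by (simp add: stretched_prob_def)

lemma stretched_prob_ge:
  assumes "real k \<le> z * real n powr gam \<alpha>" "0 \<le> z"
  shows "norm_const \<alpha> * exp (- (real n powr (gam \<alpha> * \<alpha>) * z powr \<alpha>)) \<le> stretched_prob \<alpha> k"
proof -
  have "real k powr \<alpha> \<le> (z * real n powr gam \<alpha>) powr \<alpha>"
    using assms \<alpha> by (intro powr_mono2) auto
  also have "\<dots> = real n powr (gam \<alpha> * \<alpha>) * z powr \<alpha>"
    using assms by (simp add: powr_mult powr_powr mult.commute)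
  finally show ?thesis
    using norm_const_pos[OF \<alpha>(1)] by (simp add: stretched_prob_def)
qed

text \<open>In the lists \<open>full xs\<close> only the bulk \<open>xs\<close> and the corrective
  entry determined by it vary; the other values are fixed. Each list therefore weighs at least a
  common factor \<open>D\<close> times the weight of its bulk.\<close>

lemma max_event_lower:
  assumes t: "t \<longlonglongrightarrow> s" and \<kappa>: "0 < \<kappa>"
    and v: "\<And>n. 1 \<le> n \<Longrightarrow> \<mu> * real n + t n * real n powr gam \<alpha> \<in> \<nat>"
    and U: "openin (top_of_set {0..}) U" and y: "y \<in> U"
  shows "\<forall>\<^sub>F n in sequentially. exp (- (real n powr (gam \<alpha> * \<alpha>) * (f_fun \<alpha> \<sigma> s y + \<kappa>)))
     \<le> prob (max_event U n (\<mu> * real n + t n * real n powr gam \<alpha>))"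
proof -
  note \<gamma> = gam_bounds[OF \<alpha>]
  have y0: "0 \<le> y"
    using openin_imp_subset[OF U] y by auto
  obtain \<rho> where \<rho>: "0 < \<rho>" "\<And>z. 0 \<le> z \<Longrightarrow> \<bar>z - y\<bar> < \<rho> \<Longrightarrow> z \<in> U"
    using U y unfolding openin_euclidean_subtopology_iff by (auto simp: dist_real_def)
  have "f_fun \<alpha> \<sigma> s y < f_fun \<alpha> \<sigma> s y + \<kappa> / 2"
    using \<kappa> by simp
  then obtain x where x: "x \<in> dec_seqs" "x 0 = y" "summable (\<lambda>j. x j powr \<alpha>)" "summable x"
      "F_real \<alpha> \<sigma> s x < f_fun \<alpha> \<sigma> s y + \<kappa> / 2"
    by (elim f_fun_approx[OF y0])
  have x_nn: "0 \<le> x j" and x_le: "x j \<le> y" for j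
    using x by (auto simp: dec_seqs_def decseq_def)
  \<comment> \<open>Truncation lowers the cost of the jumps but may raise the quadratic term, so
    \<open>m\<close> is taken from the limit. Requiring \<open>1 \<le> m\<close> preserves the head
    \<open>y\<close>.\<close>
  have "(\<lambda>m. (\<Sum>j<m. x j powr \<alpha>) + (s - (\<Sum>j<m. x j))\<^sup>2 / (2 * \<sigma>\<^sup>2)) \<longlonglongrightarrow> F_real \<alpha> \<sigma> s x"
    unfolding F_real_def using sigma_nonzero
    by (intro tendsto_intros summable_LIMSEQ x) auto
  then have "\<forall>\<^sub>F m in sequentially. (\<Sum>j<m. x j powr \<alpha>) + (s - (\<Sum>j<m. x j))\<^sup>2 / (2 * \<sigma>\<^sup>2) < f_fun \<alpha> \<sigma> s y + \<kappa> / 2"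
    using x(5) by (rule order_tendstoD)
  then have "\<forall>\<^sub>F m in sequentially. 1 \<le> m \<and> (\<Sum>j<m. x j powr \<alpha>) + (s - (\<Sum>j<m. x j))\<^sup>2 / (2 * \<sigma>\<^sup>2) < f_fun \<alpha> \<sigma> s y + \<kappa> / 2"
    using eventually_ge_at_top[of 1] by eventually_elim simp
  then obtain m where m: "1 \<le> m" "(\<Sum>j<m. x j powr \<alpha>) + (s - (\<Sum>j<m. x j))\<^sup>2 / (2 * \<sigma>\<^sup>2) < f_fun \<alpha> \<sigma> s y + \<kappa> / 2"
    using eventually_happens'[OF sequentially_bot] by blast
  define A where "A = (\<Sum>j<m. x j powr \<alpha>)"
  define W where "W = (\<Sum>j<m. x j)"
  define u where "u = s - W"
  have Au: "A + \<bar>u\<bar>\<^sup>2 / (2 * \<sigma>\<^sup>2) < f_fun \<alpha> \<sigma> s y + \<kappa> / 2"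
    using m(2) by (simp add: A_def W_def u_def)
  have "((\<lambda>d. (3 * d) powr \<alpha> + (\<bar>u\<bar> + 2 * d)\<^sup>2 / (2 * \<sigma>\<^sup>2)) \<longlongrightarrow> (3 * 0) powr \<alpha> + (\<bar>u\<bar> + 2 * 0)\<^sup>2 / (2 * \<sigma>\<^sup>2)) (at_right 0)"
    using \<alpha> sigma_nonzero by (intro tendsto_intros tendsto_powr') (auto simp: eventually_at_filter)
  then have "\<forall>\<^sub>F d in at_right 0. (3 * d) powr \<alpha> + (\<bar>u\<bar> + 2 * d)\<^sup>2 / (2 * \<sigma>\<^sup>2) < \<bar>u\<bar>\<^sup>2 / (2 * \<sigma>\<^sup>2) + \<kappa> / 4"
    using \<kappa> by (intro order_tendstoD) auto
  then obtain d1 where d1: "0 < d1" "\<And>d. 0 < d \<Longrightarrow> d < d1 \<Longrightarrow> (3 * d) powr \<alpha> + (\<bar>u\<bar> + 2 * d)\<^sup>2 / (2 * \<sigma>\<^sup>2) < \<bar>u\<bar>\<^sup>2 / (2 * \<sigma>\<^sup>2) + \<kappa> / 4"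
    by (auto simp: eventually_at_right_field)
  \<comment> \<open>The first bound limits the extra cost of the corrective summand and of the
    shortfall to \<open>\<kappa> / 4\<close>; the second prevents the corrective summand, of
    rescaled size at most \<open>3 * \<delta>\<close>, from lifting the maximum out of
    \<open>U\<close>.\<close>
  define \<delta> where "\<delta> = min (d1 / 2) (\<rho> / 6)"
  have \<delta>': "0 < \<delta>" "3 * \<delta> \<le> \<rho> / 2" "\<delta> < d1"
    using d1(1) \<rho>(1) by (auto simp: \<delta>_def)
  have \<delta>: "0 < \<delta>" "3 * \<delta> \<le> \<rho> / 2"
      "(3 * \<delta>) powr \<alpha> + (\<bar>u\<bar> + 2 * \<delta>)\<^sup>2 / (2 * \<sigma>\<^sup>2) \<le> \<bar>u\<bar>\<^sup>2 / (2 * \<sigma>\<^sup>2) + \<kappa> / 4"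
    using \<delta>' d1(2)[OF \<delta>'(1,3)] by auto
  define \<Lambda> where "\<Lambda> = - ln (norm_const \<alpha>)"
  have c: "0 < norm_const \<alpha>" "norm_const \<alpha> = exp (- \<Lambda>)"
    using norm_const_pos[OF \<alpha>(1)] by (auto simp: \<Lambda>_def)
  have \<Lambda>: "0 \<le> \<Lambda>"
    using c(1) norm_const_le_1 by (simp add: \<Lambda>_def)
  \<comment> \<open>One term per requirement: \<open>1 \<le> T\<close>, a sufficient Gaussian
    prefactor (\<open>T2\<close>), and zeros that cost at most \<open>\<kappa> / 8\<close> per unit
    of \<open>N\<close> (\<open>T3\<close>).\<close>
  define T where "T = 1 + 8 * \<bar>\<sigma>\<bar> * sqrt (2 * pi) / \<delta> + 8 * \<Lambda> / \<kappa>"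
  have T1: "1 \<le> T"
    using \<delta> \<kappa> \<Lambda> by (simp add: T_def)
  have "8 * \<bar>\<sigma>\<bar> * sqrt (2 * pi) / \<delta> \<le> T"
    using \<kappa> \<Lambda> by (simp add: T_def)
  then have T2: "8 * \<bar>\<sigma>\<bar> * sqrt (2 * pi) \<le> \<delta> * T"
    using \<delta> by (simp add: field_simps)
  have "8 * \<Lambda> / \<kappa> \<le> T"
    using \<delta> by (simp add: T_def)
  also have "T \<le> T\<^sup>2"
    using T1 by (simp add: power2_eq_square)
  finally have T3: "\<Lambda> / T\<^sup>2 \<le> \<kappa> / 8"
    using \<kappa> T1 by (simp add: field_simps)
  \<comment> \<open>The mismatches in the sum, in units of \<open>n\<^sup>\<gamma>\<close>: the
    convergence of \<open>t n\<close>, rounding of the \<open>m\<close> planted values, the missing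
    mean of the \<open>m + 1\<close> planted entries, and that of at most \<open>N\<close>
    zeros.\<close>
  have lim1: "(\<lambda>n. \<bar>t n - s\<bar> + (real m + \<mu> * (real m + 1)) * real n powr (- gam \<alpha>) + \<mu> * real n powr (gam \<alpha> - 1))
      \<longlonglongrightarrow> \<bar>s - s\<bar> + (real m + \<mu> * (real m + 1)) * 0 + \<mu> * 0"
    using \<gamma> by (intro tendsto_intros t tendsto_neg_powr filterlim_real_sequentially) auto
  have ev1: "\<forall>\<^sub>F n in sequentially. \<bar>t n - s\<bar> + (real m + \<mu> * (real m + 1)) * real n powr (- gam \<alpha>) + \<mu> * real n powr (gam \<alpha> - 1) < \<delta>"
    using order_tendstoD(2)[OF lim1, of \<delta>] \<delta> by simp
  have "(\<lambda>n. real n powr (- gam \<alpha>)) \<longlonglongrightarrow> 0"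
    using \<gamma> by (intro tendsto_neg_powr filterlim_real_sequentially) auto
  then have ev2: "\<forall>\<^sub>F n in sequentially. real n powr (- gam \<alpha>) < \<rho>"
    using \<rho>(1) by (rule order_tendstoD)
  have "0 < gam \<alpha> * \<alpha>"
    using \<gamma> by simp
  then have "filterlim (\<lambda>n. real n powr (gam \<alpha> * \<alpha>)) at_top sequentially"
    by real_asymp
  then have ev3: "\<forall>\<^sub>F n in sequentially. 8 * (real m + 1) * \<Lambda> / \<kappa> \<le> real n powr (gam \<alpha> * \<alpha>)"
    by (simp add: filterlim_at_top)
  have "0 < \<rho> / 2" "0 < T"
    using \<rho>(1) T1 by auto
  from moderate_deviation_lists[OF \<delta>(1) this T2, of m u] show ?thesis
    using ev1 ev2 ev3 eventually_gt_at_top[of "m + 1"]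
  proof eventually_elim
    case (elim n)
    define r where "r = real n powr gam \<alpha>"
    define N where "N = real n powr (gam \<alpha> * \<alpha>)"
    have n0: "0 < real n" and r0: "0 < r" and N0: "0 < N"
      using elim by (auto simp: r_def N_def)
    obtain p E where p: "p + m + 1 \<le> n" "real (n - m - 1 - p) \<le> N / T\<^sup>2"
      and E: "E \<subseteq> bounded_lists p (\<rho> / 2 * r) (real p * \<mu> + (u - 2 * \<delta>) * r) (real p * \<mu> + (u - \<delta>) * r)"
      and wE: "exp (- (N * ((\<bar>u\<bar> + 2 * \<delta>)\<^sup>2 / (2 * \<sigma>\<^sup>2)))) \<le> (\<Sum>xs\<in>E. list_weight \<alpha> xs)"
      using elim(1) unfolding r_def N_def by blast
    define q where "q = n - m - 1 - p"
    have npq: "real n = real p + real m + 1 + real q"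
      using p(1) by (simp add: q_def)
    have fE: "finite E"
      using finite_subset[OF E finite_bounded_lists] .
    define k where "k j = nat \<lfloor>x j * r\<rfloor>" for j
    have k_le: "real (k j) \<le> x j * r" for j
      using x_nn r0 by (simp add: k_def)
    have k_ge: "x j * r - 1 \<le> real (k j)" for j
      unfolding k_def by linarith
    define ks where "ks = map k [0..<m]"
    have sum_ks: "real (sum_list ks) = (\<Sum>j<m. real (k j))"
      by (simp add: ks_def interv_sum_list_conv_sum_set_nat atLeast0LessThan)
    have ks_le: "real (sum_list ks) \<le> W * r"
      unfolding sum_ks W_def sum_distrib_right by (intro sum_mono k_le)
    have "(\<Sum>j<m. x j * r - 1) \<le> (\<Sum>j<m. real (k j))"
      by (intro sum_mono k_ge)
    then have ks_ge: "W * r - real m \<le> real (sum_list ks)"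
      by (simp add: sum_ks W_def sum_distrib_right sum_subtractf)
    have "1 \<le> n"
      using elim by simp
    from v[OF this] obtain vn where vn: "real vn = \<mu> * real n + t n * r"
      unfolding r_def by (auto elim: Nats_cases)
    \<comment> \<open>One entry is spent on hitting the prescribed sum exactly, so that no local limit theorem is needed; its cost
      \<open>(3 * \<delta>) powr \<alpha>\<close> vanishes with \<open>\<delta>\<close>.\<close>
    define j where "j xs = vn - (sum_list ks + sum_list xs)" for xs
    define full where "full xs = ks @ [j xs] @ replicate q 0 @ xs" for xs
    have bounds: "length xs = p" "\<And>z. z \<in> set xs \<Longrightarrow> real z \<le> \<rho> / 2 * r"
        "real p * \<mu> + (u - 2 * \<delta>) * r \<le> real (sum_list xs)" "real (sum_list xs) \<le> real p * \<mu> + (u - \<delta>) * r"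
      if "xs \<in> E" for xs
      using subsetD[OF E that] by (auto simp: bounded_lists_def)
    have q_le: "real q \<le> N"
    proof -
      have "N / T\<^sup>2 \<le> N"
        using T1 N0 by (simp add: field_simps one_le_power)
      then show ?thesis
        using p(2) by (simp add: q_def)
    qed
    have \<delta>r: "\<bar>t n - s\<bar> * r + real m + \<mu> * (real m + 1 + real q) \<le> \<delta> * r"
    proof -
      have "real n powr (- gam \<alpha>) * r = 1" "real n powr (gam \<alpha> - 1) * r = N"
        using n0 unfolding r_def N_def \<gamma>(3) by (simp_all flip: powr_add)
      then have "(\<bar>t n - s\<bar> + (real m + \<mu> * (real m + 1)) * real n powr (- gam \<alpha>) + \<mu> * real n powr (gam \<alpha> - 1)) * r
          = \<bar>t n - s\<bar> * r + (real m + \<mu> * (real m + 1)) + \<mu> * N"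
        by (simp add: distrib_right mult.assoc)
      moreover have "\<mu> * real q \<le> \<mu> * N"
        using q_le mean_nonneg by (rule mult_left_mono)
      ultimately show ?thesis
        using mult_right_mono[OF less_imp_le[OF elim(2)], of r] r0 by (simp add: distrib_left)
    qed
    have j: "real (j xs) \<le> 3 * \<delta> * r" "sum_list (full xs) = vn" if xs: "xs \<in> E" for xs
    proof -
      have tsr: "\<bar>t n * r - s * r\<bar> = \<bar>t n - s\<bar> * r"
        using r0 by (simp add: left_diff_distrib[symmetric] abs_mult)
      have mun: "\<mu> * real n = \<mu> * (real m + 1 + real q) + real p * \<mu>"
        by (simp add: npq algebra_simps)
      have mu0: "0 \<le> \<mu> * (real m + 1 + real q)"
        using mean_nonneg by simp
      have ur: "(u - \<delta>) * r = s * r - W * r - \<delta> * r" "(u - 2 * \<delta>) * r = s * r - W * r - 2 * (\<delta> * r)"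
        by (simp_all only: u_def left_diff_distrib mult.assoc)
      \<comment> \<open>The bulk falls short by at least \<open>\<delta> * r\<close>, which absorbs
        all mismatches by the fact \<open>\<delta>r\<close>; so the natural subtraction in
        \<open>j\<close> is not truncated. It falls short by at most
        \<open>2 * \<delta> * r\<close>, which gives the bound \<open>3 * \<delta> * r\<close>
        below.\<close>
      have "real (sum_list ks) + real (sum_list xs) \<le> real vn"
        using bounds(4)[OF xs, unfolded ur] ks_le \<delta>r mu0 tsr mun unfolding vn by linarith
      then have le: "sum_list ks + sum_list xs \<le> vn"
        by linarith
      then have "real (j xs) = real vn - real (sum_list ks) - real (sum_list xs)"
        by (simp add: j_def of_nat_diff)
      also have "\<dots> \<le> 3 * \<delta> * r"
        using bounds(3)[OF xs, unfolded ur] ks_ge \<delta>r tsr mun unfolding vn mult.assoc by linarith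
      finally show "real (j xs) \<le> 3 * \<delta> * r" .
      show "sum_list (full xs) = vn"
        using le by (simp add: full_def j_def sum_list_replicate)
    qed
    have len: "length (full xs) = n" if "xs \<in> E" for xs
      using bounds(1)[OF that] p(1) by (simp add: full_def ks_def q_def)
    have inj: "inj_on full E"
      by (auto simp: inj_on_def full_def)
    have sub: "{\<omega> \<in> space M. map (\<lambda>i. X i \<omega>) [1..<Suc n] \<in> full ` E}
        \<subseteq> max_event U n (\<mu> * real n + t n * real n powr gam \<alpha>)"
    proof safe
      fix \<omega> xs assume \<omega>: "\<omega> \<in> space M" "map (\<lambda>i. X i \<omega>) [1..<Suc n] = full xs" and xs: "xs \<in> E"
      have ps: "partial_sum X n \<omega> = vn"
        unfolding partial_sum_list \<omega>(2) using j(2)[OF xs] .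
      define mx where "mx = partial_max X n \<omega>"
      have mx: "mx = Max (set (full xs))"
        unfolding mx_def partial_max_list \<omega>(2) ..
      have up: "real z \<le> (y + \<rho> / 2) * r" if "z \<in> set (full xs)" for z
      proof -
        have 1: "y * r + 0 \<le> (y + \<rho> / 2) * r" "\<rho> / 2 * r \<le> (y + \<rho> / 2) * r" "0 \<le> (y + \<rho> / 2) * r"
          using r0 \<rho>(1) y0 by (auto intro!: mult_right_mono mult_nonneg_nonneg)
        have 2: "3 * \<delta> * r \<le> \<rho> / 2 * r"
          using \<delta>(2) r0 by (intro mult_right_mono) auto
        have 3: "real (k i) \<le> y * r" for i
          using k_le[of i] mult_right_mono[OF x_le[of i], of r] r0 by linarith
        from that consider i where "z = k i" | "z = j xs" | "z = 0" | "z \<in> set xs"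
          by (auto simp: full_def ks_def)
        then show ?thesis
        proof cases
          case 1
          then show ?thesis
            using 3[of i] \<open>y * r + 0 \<le> _\<close> by simp
        next
          case 2
          then show ?thesis
            using j(1)[OF xs] \<open>3 * \<delta> * r \<le> _\<close> \<open>\<rho> / 2 * r \<le> _\<close> by simp
        next
          case 3
          then show ?thesis
            using \<open>0 \<le> (y + \<rho> / 2) * r\<close> by simp
        next
          case 4
          then show ?thesis
            using bounds(2)[OF xs] \<open>\<rho> / 2 * r \<le> _\<close> by (meson order_trans)
        qed
      qed
      \<comment> \<open>\<open>k 0\<close> is the rounded head \<open>x 0 = y\<close> and bounds the
        maximum from below; \<open>up\<close> bounds it from above.\<close>
      have "k 0 \<in> set (full xs)"
        using m(1) by (auto simp: full_def ks_def)
      then have "real (k 0) \<le> real mx" "mx \<in> set (full xs)"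
        unfolding mx by (auto intro!: Max_in)
      then have "y * r - 1 \<le> real mx" "real mx \<le> (y + \<rho> / 2) * r"
        using k_ge[of 0] x(2) up by auto
      then have "(y * r - 1) / r \<le> real mx / r" "real mx / r \<le> y + \<rho> / 2"
        using r0 by (auto intro: divide_right_mono simp: pos_divide_le_eq)
      then have "y - 1 / r \<le> real mx / r" "real mx / r \<le> y + \<rho> / 2"
        using r0 by (simp_all add: diff_divide_distrib)
      moreover have "1 / r < \<rho>"
        using elim(3) by (simp add: r_def powr_minus_divide)
      ultimately have "\<bar>real mx / r - y\<bar> < \<rho>"
        using \<rho>(1) by linarith
      then have "real mx / r \<in> U"
        using r0 by (intro \<rho>(2)) auto
      then show "\<omega> \<in> max_event U n (\<mu> * real n + t n * real n powr gam \<alpha>)"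
        using \<omega>(1) ps vn by (simp add: max_event_def mx_def r_def)
    qed
    \<comment> \<open>Each of the \<open>m + 1 + q\<close> entries outside the bulk contributes a
      normalising constant \<open>exp (- \<Lambda>)\<close>; zeros cost nothing beyond it.\<close>
    define D where "D = exp (- (\<Lambda> * (real m + 1 + real q)) - N * (A + (3 * \<delta>) powr \<alpha>))"
    have w: "D * list_weight \<alpha> xs \<le> list_weight \<alpha> (full xs)" if xs: "xs \<in> E" for xs
    proof -
      have "(\<Prod>j<m. norm_const \<alpha> * exp (- (N * x j powr \<alpha>))) \<le> (\<Prod>j<m. stretched_prob \<alpha> (k j))"
        using c(1) x_nn k_le unfolding N_def r_def by (intro prod_mono) (auto intro!: stretched_prob_ge)
      also have "\<dots> = list_weight \<alpha> ks"
        by (simp add: ks_def list_weight_def prod.list_conv_set_nth atLeast0LessThan)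
      also have "(\<Prod>j<m. norm_const \<alpha> * exp (- (N * x j powr \<alpha>))) = norm_const \<alpha> ^ m * exp (- (N * A))"
        by (simp add: prod.distrib A_def sum_distrib_left sum_negf flip: exp_sum)
      finally have 1: "norm_const \<alpha> ^ m * exp (- (N * A)) \<le> list_weight \<alpha> ks" .
      have 2: "norm_const \<alpha> * exp (- (N * (3 * \<delta>) powr \<alpha>)) \<le> list_weight \<alpha> [j xs]"
        using stretched_prob_ge[of "j xs" "3 * \<delta>" n] j(1)[OF xs] \<delta>(1) by (simp add: list_weight_def N_def r_def)
      have "D = (norm_const \<alpha> ^ m * exp (- (N * A))) * ((norm_const \<alpha> * exp (- (N * (3 * \<delta>) powr \<alpha>))) * norm_const \<alpha> ^ q)"
        unfolding D_def c(2) by (simp add: algebra_simps flip: exp_add exp_of_nat_mult)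
      also have "\<dots> \<le> list_weight \<alpha> ks * (list_weight \<alpha> [j xs] * norm_const \<alpha> ^ q)"
        using 1 2 c(1) by (intro mult_mono mult_nonneg_nonneg) (auto simp: list_weight_def stretched_prob_pos less_imp_le intro!: prod_list_nonneg)
      finally have "D \<le> list_weight \<alpha> ks * (list_weight \<alpha> [j xs] * norm_const \<alpha> ^ q)" .
      moreover have "0 \<le> list_weight \<alpha> xs"
        unfolding list_weight_def by (intro prod_list_nonneg) (auto simp: stretched_prob_pos less_imp_le)
      ultimately show ?thesis
        unfolding full_def list_weight_append list_weight_replicate_0
        by (metis (no_types, lifting) mult.assoc mult_right_mono)
    qed
    \<comment> \<open>Of the slack \<kappa>, one half goes to near-optimality and truncation of
      \<open>x\<close>, a quarter to \<delta>, one eighth to the normalising constants of the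
      \<open>m + 1\<close> planted entries and one eighth to the zeros.\<close>
    have "exp (- (N * (f_fun \<alpha> \<sigma> s y + \<kappa>))) \<le> D * exp (- (N * ((\<bar>u\<bar> + 2 * \<delta>)\<^sup>2 / (2 * \<sigma>\<^sup>2))))"
    proof -
      have "\<Lambda> * (real m + 1) \<le> N * (\<kappa> / 8)"
        using elim(4) \<kappa> by (simp add: N_def field_simps)
      moreover have "\<Lambda> * real q \<le> \<Lambda> * (N / T\<^sup>2)"
        using p(2) \<Lambda> unfolding q_def by (intro mult_left_mono) auto
      moreover have "\<Lambda> * (N / T\<^sup>2) \<le> N * (\<kappa> / 8)"
        using mult_left_mono[OF T3, of N] N0 by (simp add: mult.commute)
      moreover have "N * (A + ((3 * \<delta>) powr \<alpha> + (\<bar>u\<bar> + 2 * \<delta>)\<^sup>2 / (2 * \<sigma>\<^sup>2))) \<le> N * (f_fun \<alpha> \<sigma> s y + \<kappa> * (3 / 4))"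
        using Au \<delta>(3) N0 by (intro mult_left_mono) auto
      ultimately have "\<Lambda> * (real m + 1) + \<Lambda> * real q + N * (A + ((3 * \<delta>) powr \<alpha> + (\<bar>u\<bar> + 2 * \<delta>)\<^sup>2 / (2 * \<sigma>\<^sup>2)))
          \<le> N * (\<kappa> / 8) + N * (\<kappa> / 8) + N * (f_fun \<alpha> \<sigma> s y + \<kappa> * (3 / 4))"
        by linarith
      also have "\<dots> = N * (f_fun \<alpha> \<sigma> s y + \<kappa>)"
        by (simp add: algebra_simps)
      finally have "exp (- (N * (f_fun \<alpha> \<sigma> s y + \<kappa>))) \<le> exp (- (\<Lambda> * (real m + 1) + \<Lambda> * real q
          + N * (A + ((3 * \<delta>) powr \<alpha> + (\<bar>u\<bar> + 2 * \<delta>)\<^sup>2 / (2 * \<sigma>\<^sup>2)))))"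
        by simp
      also have "\<dots> = D * exp (- (N * ((\<bar>u\<bar> + 2 * \<delta>)\<^sup>2 / (2 * \<sigma>\<^sup>2))))"
        unfolding D_def exp_add[symmetric] by (simp only: exp_inj_iff distrib_left)
      finally show ?thesis .
    qed
    also have "\<dots> \<le> D * (\<Sum>xs\<in>E. list_weight \<alpha> xs)"
      using wE by (intro mult_left_mono) (auto simp: D_def)
    also have "\<dots> \<le> (\<Sum>xs\<in>E. list_weight \<alpha> (full xs))"
      unfolding sum_distrib_left by (intro sum_mono w)
    also have "\<dots> = (\<Sum>zs\<in>full ` E. list_weight \<alpha> zs)"
      by (simp add: sum.reindex[OF inj])
    also have "\<dots> = prob {\<omega> \<in> space M. map (\<lambda>i. X i \<omega>) [1..<Suc n] \<in> full ` E}"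
      using fE len by (intro prob_lists[symmetric]) auto
    also have "\<dots> \<le> prob (max_event U n (\<mu> * real n + t n * real n powr gam \<alpha>))"
      by (intro finite_measure_mono sub max_event_events)
    finally show ?case
      by (simp add: N_def)
  qed
qed

end

section \<open>The large deviation principle\<close>

lemma elog_divide_le:
  assumes "p \<le> exp (- (a * r))" "0 < a" "0 \<le> p"
  shows "elog p / ereal a \<le> ereal (- r)"
proof (cases "p = 0")
  case True
  then show ?thesis
    using assms by (simp add: elog_def)
next
  case False
  then have "ln p \<le> ln (exp (- (a * r)))"
    using assms by (subst ln_le_cancel_iff) auto
  then have "ln p \<le> - (a * r)"
    by simp
  then show ?thesis
    using False assms by (simp add: elog_def field_simps)
qed

lemma elog_divide_ge:
  assumes "exp (- (a * r)) \<le> p" "0 < a"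
  shows "ereal (- r) \<le> elog p / ereal a"
proof -
  have p: "0 < p"
    using assms by (meson exp_gt_zero less_le_trans)
  then have "- (a * r) \<le> ln p"
    using assms by (simp add: ln_ge_iff)
  then show ?thesis
    using p assms by (simp add: elog_def field_simps)
qed

text \<open>Real test values \<open>r\<close> below \<open>a\<close> suffice even if
  \<open>a\<close> is infinite, which is the case of an empty closed set.\<close>

lemma le_uminus_erealI:
  fixes L a :: ereal
  assumes "\<And>r e. ereal r < a \<Longrightarrow> 0 < e \<Longrightarrow> L \<le> ereal (e - r)"
  shows "L \<le> - a"
proof (rule ccontr)
  assume "\<not> L \<le> - a"
  then have "- a < L"
    by simp
  then obtain x where x: "- a < ereal x" "ereal x < L"
    using ereal_dense2 by blast
  then obtain y where y: "x < y" "ereal y < L"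
    using ereal_dense2[OF x(2)] by auto
  have "ereal (- x) < a"
    using x(1) by (simp add: ereal_uminus_less_reorder flip: uminus_ereal.simps(1))
  then have "L \<le> ereal (y - x - - x)"
    using y(1) by (intro assms) auto
  then show False
    using y(2) by simp
qed

lemma uminus_INF_le_erealI:
  fixes L :: ereal
  assumes "\<And>y e. y \<in> U \<Longrightarrow> 0 < e \<Longrightarrow> ereal (- (g y + e)) \<le> L"
  shows "- (INF y\<in>U. ereal (g y)) \<le> L"
proof (rule ccontr)
  assume "\<not> ?thesis"
  then have "(INF y\<in>U. ereal (g y)) < - L"
    by (simp add: ereal_less_uminus_reorder)
  then obtain y where y: "y \<in> U" "ereal (g y) < - L"
    by (auto simp: INF_less_iff)
  then obtain x where x: "g y < x" "ereal x < - L"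
    using ereal_dense2[OF y(2)] by auto
  have "ereal (- (g y + (x - g y))) \<le> L"
    using x(1) y(1) by (intro assms) auto
  then have "- ereal x \<le> L"
    by simp
  then show False
    using x(2) by (metis ereal_less_uminus_reorder not_less)
qed

context stretched_iid
begin

definition event_prob :: "(nat \<Rightarrow> real) \<Rightarrow> real set \<Rightarrow> nat \<Rightarrow> real" where
  "event_prob t A n = prob (max_event A n (\<mu> * real n + t n * real n powr gam \<alpha>))"

lemma measure_cond_max_law_eq:
  assumes A: "A \<in> sets borel" "A \<subseteq> {0..}" and n: "1 \<le> n"
  shows "measure (cond_max_law M X \<alpha> n (\<mu> * real n + t n * real n powr gam \<alpha>)) A = event_prob t A n / event_prob t {0..} n"
proof -
  have "{\<omega> \<in> space M. real (partial_sum X n \<omega>) = v} = max_event {0..} n v" for v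
    by (simp add: max_event_def)
  then show ?thesis
    using measure_cond_max_law[OF X_measurable A n, where v = "\<mu> * real n + t n * real n powr gam \<alpha>"]
    by (simp add: cond_prob_def event_prob_def max_event_def)
qed

lemma large_deviation_principle:
  fixes s :: real and t :: "nat \<Rightarrow> real"
  assumes v: "\<And>n. 1 \<le> n \<Longrightarrow> \<mu> * real n + t n * real n powr gam \<alpha> \<in> \<nat>" and t: "t \<longlonglongrightarrow> s"
  shows "satisfies_LDP_on {0..}
     (\<lambda>n. cond_max_law M X \<alpha> n (\<mu> * real n + t n * real n powr gam \<alpha>))
     (\<lambda>n. real n powr (gam \<alpha> * \<alpha>))
     (\<lambda>y. ereal (f_fun \<alpha> \<sigma> s y - (INF z\<in>{0..}. f_fun \<alpha> \<sigma> s z)))"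
proof -
  define m where "m = (INF z\<in>{0..}. f_fun \<alpha> \<sigma> s z)"
  let ?N = "\<lambda>n. real n powr (gam \<alpha> * \<alpha>)"
  let ?Q = "\<lambda>n. cond_max_law M X \<alpha> n (\<mu> * real n + t n * real n powr gam \<alpha>)"
  have bdd: "bdd_below (f_fun \<alpha> \<sigma> s ` {0..})"
    by (rule bdd_belowI2[of _ 0]) (simp add: f_fun_nonneg)
  have m_le: "m \<le> f_fun \<alpha> \<sigma> s y" if "y \<in> {0..}" for y
    unfolding m_def using bdd that by (rule cINF_lower)
  \<comment> \<open>The lower bound for the whole half-line at a near-minimiser of \<open>f\<close>.
    It also shows that the conditioning event eventually has positive probability.\<close>
  have total_ge: "\<forall>\<^sub>F n in sequentially. exp (- (?N n * (m + \<kappa>))) \<le> event_prob t {0..} n" if \<kappa>: "0 < \<kappa>" for \<kappa>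
  proof -
    have "m < m + \<kappa> / 2"
      using \<kappa> by simp
    then obtain y where y: "y \<in> {0..}" "f_fun \<alpha> \<sigma> s y < m + \<kappa> / 2"
      unfolding m_def using bdd by (subst (asm) cINF_less_iff) auto
    have "\<forall>\<^sub>F n in sequentially. exp (- (?N n * (f_fun \<alpha> \<sigma> s y + \<kappa> / 2))) \<le> event_prob t {0..} n"
      unfolding event_prob_def using \<kappa> y by (intro max_event_lower[OF t _ v]) auto
    then show ?thesis
    proof eventually_elim
      case (elim n)
      have "?N n * (f_fun \<alpha> \<sigma> s y + \<kappa> / 2) \<le> ?N n * (m + \<kappa>)"
        using y by (intro mult_left_mono) auto
      then show ?case
        using elim by (meson exp_le_cancel_iff neg_le_iff_le order_trans)
    qed
  qed
  have total_le: "\<forall>\<^sub>F n in sequentially. event_prob t {0..} n \<le> exp (- (?N n * (m - \<kappa>)))" if \<kappa>: "0 < \<kappa>" for \<kappa>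
    unfolding event_prob_def using m_le by (intro max_event_upper[OF t \<kappa>])
  have upper: "limsup (\<lambda>n. elog (measure (?Q n) A) / ereal (?N n)) \<le> - (INF y\<in>A. ereal (f_fun \<alpha> \<sigma> s y - m))"
    if A: "closedin (top_of_set {0..}) A" for A
  proof -
    have A': "A \<in> sets borel" "A \<subseteq> {0..}"
      using A closedin_closed_trans[OF A] by (auto dest: closedin_imp_subset)
    have "limsup (\<lambda>n. elog (measure (?Q n) A) / ereal (?N n)) \<le> ereal (e - r)"
      if r: "ereal r < (INF y\<in>A. ereal (f_fun \<alpha> \<sigma> s y - m))" and e: "0 < e" for r e
    proof (rule Limsup_bounded)
      have "r + m \<le> f_fun \<alpha> \<sigma> s y" if "y \<in> A" for y
        using less_INF_D[OF r that] by simp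
      then have "\<forall>\<^sub>F n in sequentially. event_prob t A n \<le> exp (- (?N n * (r + m - e / 2)))"
        unfolding event_prob_def using e by (intro max_event_upper[OF t]) auto
      moreover have "\<forall>\<^sub>F n in sequentially. exp (- (?N n * (m + e / 2))) \<le> event_prob t {0..} n"
        using e by (intro total_ge) auto
      ultimately show "\<forall>\<^sub>F n in sequentially. elog (measure (?Q n) A) / ereal (?N n) \<le> ereal (e - r)"
        using eventually_ge_at_top[of 1]
      proof eventually_elim
        case (elim n)
        have "event_prob t A n / event_prob t {0..} n \<le> exp (- (?N n * (r + m - e / 2))) / exp (- (?N n * (m + e / 2)))"
          using elim by (intro frac_le) auto
        also have "\<dots> = exp (- (?N n * (r - e)))"
          by (simp add: algebra_simps flip: exp_diff)
        finally have "measure (?Q n) A \<le> exp (- (?N n * (r - e)))"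
          using measure_cond_max_law_eq[OF A' elim(3)] by simp
        moreover have "0 < ?N n"
          using elim(3) by simp
        ultimately show ?case
          using elog_divide_le[of "measure (?Q n) A" "?N n" "r - e"] by (simp only: minus_diff_eq measure_nonneg)
      qed
    qed
    then show ?thesis
      by (rule le_uminus_erealI)
  qed
  have lower: "- (INF y\<in>U. ereal (f_fun \<alpha> \<sigma> s y - m)) \<le> liminf (\<lambda>n. elog (measure (?Q n) U) / ereal (?N n))"
    if U: "openin (top_of_set {0..}) U" for U
  proof -
    have U': "U \<in> sets borel" "U \<subseteq> {0..}"
      using U by (auto simp: openin_open intro!: sets.Int)
    have "ereal (- (f_fun \<alpha> \<sigma> s y - m + e)) \<le> liminf (\<lambda>n. elog (measure (?Q n) U) / ereal (?N n))"
      if y: "y \<in> U" and e: "0 < e" for y e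
    proof (rule Liminf_bounded)
      have "\<forall>\<^sub>F n in sequentially. exp (- (?N n * (f_fun \<alpha> \<sigma> s y + e / 2))) \<le> event_prob t U n"
        unfolding event_prob_def using e by (intro max_event_lower[OF t _ v U y]) auto
      moreover have "\<forall>\<^sub>F n in sequentially. event_prob t {0..} n \<le> exp (- (?N n * (m - e / 2)))"
        using e by (intro total_le) auto
      \<comment> \<open>This is for positivity of the denominator, so any fixed slack will
        do.\<close>
      moreover have "\<forall>\<^sub>F n in sequentially. exp (- (?N n * (m + 1))) \<le> event_prob t {0..} n"
        by (intro total_ge) auto
      ultimately show "\<forall>\<^sub>F n in sequentially. ereal (- (f_fun \<alpha> \<sigma> s y - m + e)) \<le> elog (measure (?Q n) U) / ereal (?N n)"
        using eventually_ge_at_top[of 1]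
      proof eventually_elim
        case (elim n)
        have pos: "0 < event_prob t {0..} n"
          using elim(3) by (meson exp_gt_zero less_le_trans)
        have "exp (- (?N n * (f_fun \<alpha> \<sigma> s y - m + e)))
            = exp (- (?N n * (f_fun \<alpha> \<sigma> s y + e / 2))) / exp (- (?N n * (m - e / 2)))"
          by (simp add: algebra_simps flip: exp_diff)
        also have "\<dots> \<le> event_prob t U n / event_prob t {0..} n"
          using elim pos by (intro frac_le) (auto simp: event_prob_def)
        finally have "exp (- (?N n * (f_fun \<alpha> \<sigma> s y - m + e))) \<le> measure (?Q n) U"
          using measure_cond_max_law_eq[OF U' elim(4)] by simp
        moreover have "0 < ?N n"
          using elim(4) by simp
        ultimately show ?case
          by (rule elog_divide_ge)
      qed
    qed
    then show ?thesis
      by (rule uminus_INF_le_erealI)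
  qed
  show ?thesis
    unfolding satisfies_LDP_on_def m_def[symmetric] using upper lower by blast
qed

end

theorem theorem2p1:
  fixes M :: "'a measure" and X :: "nat \<Rightarrow> 'a \<Rightarrow> nat"
    and \<alpha> \<mu> \<sigma> s :: real and t :: "nat \<Rightarrow> real"
  assumes "prob_space M"
    and "0 < \<alpha>" and "\<alpha> < 1"
    and "prob_space.indep_vars M (\<lambda>_. count_space UNIV) X {1..}"
    and "\<And>i k. 1 \<le> i \<Longrightarrow>
           measure M {\<omega> \<in> space M. X i \<omega> = k} = norm_const \<alpha> * exp (- (real k powr \<alpha>))"
    and "\<And>i. 1 \<le> i \<Longrightarrow> \<mu> = prob_space.expectation M (\<lambda>\<omega>. real (X i \<omega>))"
    and "\<And>i. 1 \<le> i \<Longrightarrow> \<sigma>\<^sup>2 = prob_space.variance M (\<lambda>\<omega>. real (X i \<omega>))"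
    and "\<And>n. 1 \<le> n \<Longrightarrow> \<mu> * real n + t n * real n powr gam \<alpha> \<in> \<nat>"
    and "t \<longlonglongrightarrow> s"
  defines "I \<equiv> \<lambda>y. ereal (f_fun \<alpha> \<sigma> s y - (INF z\<in>{0..}. f_fun \<alpha> \<sigma> s z))"
  shows "good_rate_function_on {0..} I \<and>
         satisfies_LDP_on {0..}
           (\<lambda>n. cond_max_law M X \<alpha> n (\<mu> * real n + t n * real n powr gam \<alpha>))
           (\<lambda>n. real n powr (gam \<alpha> * \<alpha>)) I"
proof -
  interpret prob_space M
    by (rule assms(1))
  interpret stretched_iid M X \<alpha> \<mu> \<sigma>
  proof
    show "expectation (\<lambda>\<omega>. real (X i \<omega>)) = \<mu>" if "1 \<le> i" for i
      using assms(6)[OF that] by simp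
    show "variance (\<lambda>\<omega>. real (X i \<omega>)) = \<sigma>\<^sup>2" if "1 \<le> i" for i
      using assms(7)[OF that] by simp
    show "prob {\<omega> \<in> space M. X i \<omega> = k} = stretched_prob \<alpha> k" if "1 \<le> i" for i k
      using assms(5)[OF that] by (simp add: stretched_prob_def)
  qed (use assms in auto)
  show ?thesis
    unfolding I_def
    using good_rate_function_f_fun[OF \<alpha> sigma_nonzero] large_deviation_principle[OF assms(8,9)] by blast
qed

end
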